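(* For all $\alpha,\nu\in\mathbb C$ and $x>0$, $$\mathbf W_{\alpha,\nu}(x)=\int_{-\infty}^{\infty}e^{\nu s}\,\eta_x(s)\,ds=2\int_0^\infty\cosh(\nu s)\,\eta_x(s)\,ds,$$ where $$\eta_x(s):=2^{-3/2}\pi^{-1/2}x^{-1+2\alpha}\exp\Bigl(\frac1{2x^2}-\frac1{4x^2}\cosh^2\bigl(\tfrac s2\bigr)\Bigr)D_{2\alpha}\Bigl(\frac1x\cosh\bigl(\tfrac s2\bigr)\Bigr),$$ the integrals converging absolutely.
   Context: For $\alpha,\nu\in\mathbb C$ and $x>0$, $\mathbf W_{\alpha,\nu}(x):=2^\alpha x^{2\alpha}e^{1/(4x^2)}W_{\alpha,\nu}\bigl(\tfrac1{2x^2}\bigr)=(2x^2)^{-\frac12+\alpha+\nu}\Psi\bigl(\tfrac12-\alpha-\nu,1-2\nu;\tfrac1{2x^2}\bigr)$, where $W_{\kappa,\mu}$ is the Whittaker function of the second kind and $\Psi$ the Tricomi confluent hypergeometric function. $D_\mu$ denotes the parabolic cylinder function. *)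

theory Defs
  imports "HOL-Analysis.Analysis"
begin

text \<open>Whittaker function of the second kind W_{kappa,mu}(z) for real z > 0:
  the unique solution of Whittaker's equation
  w'' + (-1/4 + kappa/z + (1/4 - mu^2)/z^2) w = 0 on (0,inf)
  with W(z) ~ z^kappa e^{-z/2} as z -> +inf (DLMF 13.14.21).
  Values for z <= 0 are fixed to 0 (they are never used).\<close>
definition whittaker_W :: "complex \<Rightarrow> complex \<Rightarrow> real \<Rightarrow> complex" where
  "whittaker_W \<kappa> \<mu> = (THE f.
     (\<forall>z. z \<le> 0 \<longrightarrow> f z = 0) \<and>
     (\<exists>g. (\<forall>z>0. (f has_vector_derivative g z) (at z)) \<and>
          (\<forall>z>0. (g has_vector_derivative
              ((1/4 - \<kappa> / of_real z + (\<mu>\<^sup>2 - 1/4) / (of_real z)\<^sup>2) * f z)) (at z))) \<and>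
     ((\<lambda>z. f z / (exp (- of_real z / 2) * of_real z powr \<kappa>)) \<longlongrightarrow> 1) at_top)"

text \<open>Parabolic cylinder function D_mu(z) for real z: the unique solution of Weber's
  equation w'' = (z^2/4 - mu - 1/2) w on the real line with
  D_mu(z) ~ z^mu e^{-z^2/4} as z -> +inf (DLMF 12.9.1).\<close>
definition parabolic_D :: "complex \<Rightarrow> real \<Rightarrow> complex" where
  "parabolic_D \<mu> = (THE f.
     (\<exists>g. (\<forall>z. (f has_vector_derivative g z) (at z)) \<and>
          (\<forall>z. (g has_vector_derivative
              ((of_real (z\<^sup>2 / 4) - \<mu> - 1/2) * f z)) (at z))) \<and>
     ((\<lambda>z. f z / (exp (- of_real (z\<^sup>2 / 4)) * of_real z powr \<mu>)) \<longlongrightarrow> 1) at_top)"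

definition boldW :: "complex \<Rightarrow> complex \<Rightarrow> real \<Rightarrow> complex" where
  "boldW \<alpha> \<nu> x = (2::complex) powr \<alpha> * of_real x powr (2 * \<alpha>)
      * of_real (exp (1 / (4 * x\<^sup>2))) * whittaker_W \<alpha> \<nu> (1 / (2 * x\<^sup>2))"

definition eta :: "complex \<Rightarrow> real \<Rightarrow> real \<Rightarrow> complex" where
  "eta \<alpha> x s = of_real (2 powr (-3/2) * pi powr (-1/2)) * of_real x powr (-1 + 2 * \<alpha>)
      * of_real (exp (1 / (2 * x\<^sup>2) - (cosh (s/2))\<^sup>2 / (4 * x\<^sup>2)))
      * parabolic_D (2 * \<alpha>) (cosh (s/2) / x)"

end

theory Submission
  imports Defs "HOL-Probability.Distributions" "HOL-Real_Asymp.Real_Asymp"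
begin

text \<open>
  Both special functions are pinned down as recessive solutions of a second-order equation
  \<open>w'' = q w\<close>. Two such solutions have a Wronskian that is constant and tends to 0, so they are
  proportional near infinity, hence equal everywhere.

  \<open>D\<^sub>\<mu>\<close> exists: for \<open>Re \<mu> < 0\<close> it is \<open>exp (- z\<^sup>2 / 4) / \<Gamma>(-\<mu>)\<close> times the integral of
  \<open>t\<^bsup>-\<mu>-1\<^esup> exp (- t\<^sup>2 / 2 - z t)\<close> over \<open>t > 0\<close>, and the raising operator
  \<open>D \<mapsto> z D / 2 - D'\<close> passes from \<open>\<mu>\<close> to \<open>\<mu> + 1\<close>.

  Put \<open>F u = exp (- u\<^sup>2 / 4) D\<^bsub>2\<alpha>\<^esub> u\<close>, so \<open>F'' = - u F' - (2 \<alpha> + 1) F\<close>, and let \<open>J y\<close> be the integral of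
  \<open>exp (\<nu> s) F (y cosh (s / 2))\<close> over the real line. Differentiation under the integral and two integrations by
  parts in \<open>s\<close> turn this into a second-order equation for \<open>J\<close>, which says precisely that
  \<open>\<surd>z exp (z / 2) J (\<surd>(2 z))\<close> solves Whittaker's equation with parameters \<open>\<alpha>, \<nu>\<close>; Laplace's method gives its
  behaviour at infinity, so by uniqueness it is a multiple of \<open>W\<^bsub>\<alpha>,\<nu>\<^esub>\<close>.
\<close>

section \<open>Recessive solutions of linear second-order equations\<close>

text \<open>The kernel makes derivatives in s and in y match. G = F (y cosh (s / 2)) satisfies y^2
  G_yy + (y + y^3) G_y + (2 \<alpha> + 1) y^2 G = 4 G_ss: because sinh^2 = cosh^2 - 1, the part of
  G_ss that is not already made of G_yy and G_y is a multiple of F'' at u = y cosh (s / 2), and the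
  equation for F trades it for u F' = y G_y and F. Since exp (\<nu> s) is an eigenfunction of
  d^2/ds^2, integration replaces G_ss by \<nu>^2 J. The Gaussian factor in F removes the potential
  u^2 / 4 from Weber's equation, which would otherwise bring in cosh^2 weights on F itself. The
  obstacle elsewhere is that both definitions prescribe only values at infinity, while the Wronskian
  and the raising operator involve derivatives. Uniqueness therefore recovers the decay of the
  derivatives, and existence carries their leading behaviour along.\<close>

lemma linear_ode_zero_backwards:
  fixes h k q :: "real \<Rightarrow> complex"
  assumes "a \<le> b"
    and h: "\<And>z. z \<in> {a..b} \<Longrightarrow> (h has_vector_derivative k z) (at z)"
    and k: "\<And>z. z \<in> {a..b} \<Longrightarrow> (k has_vector_derivative q z * h z) (at z)"
    and q: "continuous_on {a..b} q"
    and "h b = 0" "k b = 0"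
  shows "h a = 0"
proof -
  have "bounded (q ` {a..b})"
    by (intro compact_imp_bounded compact_continuous_image q compact_Icc)
  then obtain M where M: "\<And>z. z \<in> {a..b} \<Longrightarrow> norm (q z) \<le> M"
    unfolding bounded_iff by (metis imageI)
  \<comment> \<open>An energy estimate: with |q| \<le> M the derivative of |h|^2 + |k|^2 is at least
    - (1 + M) (|h|^2 + |k|^2), because 2 |h| |k| \<le> |h|^2 + |k|^2. The exponential weight
    compensates this loss, so \<open>E\<close> is nondecreasing and ends at 0.\<close>
  define E where "E = (\<lambda>z. (h z \<bullet> h z + k z \<bullet> k z) * exp ((1 + M) * z))"
  have "E a \<le> E b"
  proof (rule DERIV_nonneg_imp_nondecreasing[OF \<open>a \<le> b\<close>])
    fix z assume z: "a \<le> z" "z \<le> b"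
    let ?D = "(2 * (h z \<bullet> k z) + 2 * (k z \<bullet> (q z * h z)) + (1 + M) * (h z \<bullet> h z + k z \<bullet> k z)) * exp ((1 + M) * z)"
    have "((\<lambda>z. h z \<bullet> h z) has_real_derivative 2 * (h z \<bullet> k z)) (at z)"
      using bounded_bilinear.has_vector_derivative[OF bounded_bilinear_inner h[of z] h[of z]] z
      by (simp add: has_real_derivative_iff_has_vector_derivative inner_commute)
    moreover have "((\<lambda>z. k z \<bullet> k z) has_real_derivative 2 * (k z \<bullet> (q z * h z))) (at z)"
      using bounded_bilinear.has_vector_derivative[OF bounded_bilinear_inner k[of z] k[of z]] z
      by (simp add: has_real_derivative_iff_has_vector_derivative inner_commute)
    ultimately have D: "(E has_real_derivative ?D) (at z)"
      unfolding E_def by (auto intro!: derivative_eq_intros simp: algebra_simps)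
    have "- (h z \<bullet> k z) \<le> norm (h z) * norm (k z)"
      using norm_cauchy_schwarz[of "- h z" "k z"] by simp
    moreover have "- (k z \<bullet> (q z * h z)) \<le> norm (k z) * (M * norm (h z))"
    proof -
      have "- (k z \<bullet> (q z * h z)) \<le> norm (k z) * norm (q z * h z)"
        using norm_cauchy_schwarz[of "- k z" "q z * h z"] by simp
      also have "\<dots> \<le> norm (k z) * (M * norm (h z))"
        using M[of z] z by (intro mult_left_mono) (auto simp: norm_mult intro: mult_right_mono)
      finally show ?thesis .
    qed
    moreover have "(1 + M) * (2 * (norm (h z) * norm (k z))) \<le> (1 + M) * ((norm (h z))\<^sup>2 + (norm (k z))\<^sup>2)"
    proof (intro mult_left_mono)
      show "2 * (norm (h z) * norm (k z)) \<le> (norm (h z))\<^sup>2 + (norm (k z))\<^sup>2"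
        using sum_squares_bound[of "norm (h z)" "norm (k z)"] by simp
      show "0 \<le> 1 + M" using order_trans[OF norm_ge_zero M[of z]] z by simp
    qed
    ultimately have "0 \<le> ?D"
      by (intro mult_nonneg_nonneg) (auto simp: algebra_simps power2_norm_eq_inner)
    then show "\<exists>y. (E has_real_derivative y) (at z) \<and> 0 \<le> y" using D by blast
  qed
  also have "E b = 0" using assms by (simp add: E_def)
  finally have "h a \<bullet> h a + k a \<bullet> k a \<le> 0"
    by (simp add: E_def mult_le_0_iff)
  moreover have "0 \<le> h a \<bullet> h a" "0 \<le> k a \<bullet> k a" by auto
  ultimately have "h a \<bullet> h a = 0" by linarith
  then show ?thesis by simp
qed

lemma has_vector_derivative_bound:
  fixes f :: "real \<Rightarrow> 'a::real_normed_vector"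
  assumes "convex S" and "\<And>u. u \<in> S \<Longrightarrow> (f has_vector_derivative f' u) (at u)"
    and "\<And>u. u \<in> S \<Longrightarrow> norm (f' u) \<le> B" and "x \<in> S" "y \<in> S"
  shows "norm (f x - f y) \<le> B * \<bar>x - y\<bar>"
proof -
  have "norm (f x - f y) \<le> B * norm (x - y)"
  proof (rule differentiable_bound[where S = S and f' = "\<lambda>u x. x *\<^sub>R f' u"])
    fix u assume u: "u \<in> S"
    show "(f has_derivative (\<lambda>x. x *\<^sub>R f' u)) (at u within S)"
      using assms(2)[OF u] by (auto simp: has_vector_derivative_def intro: has_derivative_at_withinI)
    show "onorm (\<lambda>x. x *\<^sub>R f' u) \<le> B"
    proof (rule onorm_le)
      show "norm (x *\<^sub>R f' u) \<le> B * norm x" for x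
        using mult_right_mono[OF assms(3)[OF u] abs_ge_zero[of x]] by (simp add: mult.commute)
    qed
  qed (use assms in auto)
  then show ?thesis by simp
qed

text \<open>A qualitative Landau inequality: over an interval of length 1 a small second derivative
  keeps \<open>g\<close> nearly constant, so \<open>g z\<close> is close to
  \<open>f (z+1) - f z\<close>, which is small. It supplies the decay of first derivatives that the
  Wronskian needs.\<close>

lemma derivative_tendsto_0_at_top:
  fixes f g g' :: "real \<Rightarrow> complex"
  assumes f: "\<And>z. z > a \<Longrightarrow> (f has_vector_derivative g z) (at z)"
    and g: "\<And>z. z > a \<Longrightarrow> (g has_vector_derivative g' z) (at z)"
    and "(f \<longlongrightarrow> 0) at_top" "(g' \<longlongrightarrow> 0) at_top"
  shows "(g \<longlongrightarrow> 0) at_top"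
proof (rule tendstoI)
  fix e :: real assume e: "e > 0"
  have "eventually (\<lambda>z. norm (f z) < e / 4) at_top" "eventually (\<lambda>z. norm (g' z) < e / 4) at_top"
    using assms(3,4) e by (auto simp: tendsto_iff dest: spec[of _ "e / 4"])
  then have "eventually (\<lambda>z. norm (f z) < e / 4 \<and> norm (g' z) < e / 4 \<and> z > a) at_top"
    using eventually_gt_at_top[of a] by eventually_elim auto
  then obtain N where N: "\<And>z. z \<ge> N \<Longrightarrow> norm (f z) < e / 4 \<and> norm (g' z) < e / 4 \<and> z > a"
    by (auto simp: eventually_at_top_linorder)
  have "norm (g z) < e" if z: "z \<ge> N" for z
  proof -
    have g_bound: "norm (g t - g z) \<le> e / 4" if t: "t \<in> {z..z+1}" for t
    proof -
      have "norm (g t - g z) \<le> (e / 4) * \<bar>t - z\<bar>"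
        using t z g N by (intro has_vector_derivative_bound[of "{z..z+1}" g g']) (auto simp: less_imp_le)
      also have "\<dots> \<le> (e / 4) * 1" using t e by (intro mult_left_mono) auto
      finally show ?thesis by simp
    qed
    have "norm ((f (z+1) - (z + 1) *\<^sub>R g z) - (f z - z *\<^sub>R g z)) \<le> (e / 4) * \<bar>z + 1 - z\<bar>"
    proof (rule has_vector_derivative_bound[of "{z..z+1}" _ "\<lambda>u. g u - g z"])
      fix u assume u: "u \<in> {z..z+1}"
      show "((\<lambda>t. f t - t *\<^sub>R g z) has_vector_derivative g u - g z) (at u)"
        using f[of u] N[of u] z u by (auto intro!: derivative_eq_intros)
    qed (use g_bound in auto)
    then have "norm (f (z+1) - f z - g z) \<le> e / 4"
      by (simp add: algebra_simps)
    moreover have "norm (g z) \<le> norm (f (z+1)) + norm (f z) + norm (f (z+1) - f z - g z)"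
    proof -
      show ?thesis
        using norm_triangle_ineq4[of "f (z+1) - f z" "f (z+1) - f z - g z"] norm_triangle_ineq4[of "f (z+1)" "f z"]
        by simp
    qed
    ultimately show ?thesis using N[of z] N[of "z+1"] z e by linarith
  qed
  then show "eventually (\<lambda>z. dist (g z) 0 < e) at_top"
    by (auto simp: eventually_at_top_linorder)
qed

text \<open>Decay of \<open>\<phi>\<close> and of q \<phi> makes a solution and its second
  derivative vanish at infinity, hence also the first derivative, and this forces the constant
  Wronskian to be 0. The quotient argument works only far out, where \<open>f1\<close> has no zeros;
  smaller z are reached by backward uniqueness.\<close>

lemma recessive_solution_unique:
  fixes f1 f2 g1 g2 q \<phi> :: "real \<Rightarrow> complex"
  assumes f1: "\<And>z. z > a \<Longrightarrow> (f1 has_vector_derivative g1 z) (at z)"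
    and g1: "\<And>z. z > a \<Longrightarrow> (g1 has_vector_derivative q z * f1 z) (at z)"
    and f2: "\<And>z. z > a \<Longrightarrow> (f2 has_vector_derivative g2 z) (at z)"
    and g2: "\<And>z. z > a \<Longrightarrow> (g2 has_vector_derivative q z * f2 z) (at z)"
    and lim1: "((\<lambda>z. f1 z / \<phi> z) \<longlongrightarrow> 1) at_top"
    and lim2: "((\<lambda>z. f2 z / \<phi> z) \<longlongrightarrow> 1) at_top"
    and \<phi>: "(\<phi> \<longlongrightarrow> 0) at_top" and q\<phi>: "((\<lambda>z. q z * \<phi> z) \<longlongrightarrow> 0) at_top"
    and q: "continuous_on {a<..} q"
    and z: "z > a"
  shows "f1 z = f2 z"
proof -
  \<comment> \<open>Division by zero yields 0, so a nonzero quotient says that \<open>f1\<close> and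
    \<open>\<phi>\<close> are both nonzero.\<close>
  have nz1: "eventually (\<lambda>z. f1 z / \<phi> z \<noteq> 0) at_top"
    by (rule tendsto_imp_eventually_ne[OF lim1]) simp
  have "(f \<longlongrightarrow> 0) at_top \<and> ((\<lambda>z. q z * f z) \<longlongrightarrow> 0) at_top"
    if l: "((\<lambda>z. f z / \<phi> z) \<longlongrightarrow> 1) at_top" for f
  proof
    have "((\<lambda>z. f z / \<phi> z * \<phi> z) \<longlongrightarrow> 0) at_top"
      using tendsto_mult[OF l \<phi>] by simp
    moreover have "eventually (\<lambda>z. f z / \<phi> z * \<phi> z = f z) at_top"
      using nz1 by eventually_elim auto
    ultimately show "(f \<longlongrightarrow> 0) at_top"
by (auto dest: Lim_transform_eventually)
    have "((\<lambda>z. f z / \<phi> z * (q z * \<phi> z)) \<longlongrightarrow> 0) at_top"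
      using tendsto_mult[OF l q\<phi>] by simp
    moreover have "eventually (\<lambda>z. f z / \<phi> z * (q z * \<phi> z) = q z * f z) at_top"
      using nz1 by eventually_elim auto
    ultimately show "((\<lambda>z. q z * f z) \<longlongrightarrow> 0) at_top" by (auto dest: Lim_transform_eventually)
  qed
  note dec = this[OF lim1] this[OF lim2]
  have dec': "(g1 \<longlongrightarrow> 0) at_top" "(g2 \<longlongrightarrow> 0) at_top"
    using derivative_tendsto_0_at_top[OF f1 g1] derivative_tendsto_0_at_top[OF f2 g2] dec by auto
  define w where "w = (\<lambda>z. f1 z * g2 z - f2 z * g1 z)"
  have "\<exists>c. \<forall>z\<in>{a<..}. w z = c"
  proof (rule has_vector_derivative_zero_constant)
    fix z assume "z \<in> {a<..}"
    then have "(w has_vector_derivative 0) (at z)"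
      unfolding w_def using f1[of z] f2[of z] g1[of z] g2[of z]
      by (auto intro!: derivative_eq_intros simp: algebra_simps)
    then show "(w has_vector_derivative 0) (at z within {a<..})"
      by (rule has_vector_derivative_at_within)
  qed auto
  then obtain c where c: "\<And>z. z > a \<Longrightarrow> w z = c" by auto
  have "(w \<longlongrightarrow> 0) at_top"
    unfolding w_def using dec dec' by (auto intro!: tendsto_eq_intros)
  moreover have "eventually (\<lambda>z. w z = c) at_top"
    using eventually_gt_at_top[of a] by eventually_elim (rule c)
  ultimately have "((\<lambda>_. c) \<longlongrightarrow> 0) (at_top :: real filter)" by (auto dest: Lim_transform_eventually)
  then have "c = 0" by (simp add: tendsto_const_iff)
  with c have w0: "\<And>z. z > a \<Longrightarrow> f1 z * g2 z = f2 z * g1 z" by (auto simp: w_def)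
  obtain N where N: "\<And>z. z \<ge> N \<Longrightarrow> f1 z \<noteq> 0 \<and> \<phi> z \<noteq> 0" "N > z"
  proof -
    have "eventually (\<lambda>z. f1 z \<noteq> 0 \<and> \<phi> z \<noteq> 0) at_top"
      using nz1 by eventually_elim auto
    then obtain N where "\<forall>z\<ge>N. f1 z \<noteq> 0 \<and> \<phi> z \<noteq> 0" by (auto simp: eventually_at_top_linorder)
    then show ?thesis by (intro that[of "max N (z+1)"]) auto
  qed
  \<comment> \<open>The derivative of this ratio is the Wronskian divided by f1^2. The common
    normalisation by \<open>\<phi>\<close> then forces the constant to be 1.\<close>
  have "\<exists>c. \<forall>u\<in>{N..}. f2 u / f1 u = c"
  proof (rule has_vector_derivative_zero_constant)
    fix u assume "u \<in> {N..}"
    then have u: "f1 u \<noteq> 0" "u > a" using N z by auto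
    have "((\<lambda>u. f2 u / f1 u) has_vector_derivative 0) (at u)"
      using f1[of u] f2[of u] u w0[of u] unfolding has_vector_derivative_def
      by (auto intro!: derivative_eq_intros simp: fun_eq_iff field_simps scaleR_conv_of_real)
    then show "((\<lambda>u. f2 u / f1 u) has_vector_derivative 0) (at u within {N..})"
      by (rule has_vector_derivative_at_within)
  qed auto
  then obtain r where r: "\<And>u. u \<ge> N \<Longrightarrow> f2 u / f1 u = r" by auto
  have "((\<lambda>u. (f2 u / \<phi> u) / (f1 u / \<phi> u)) \<longlongrightarrow> 1) at_top"
    using tendsto_divide[OF lim2 lim1] by simp
  moreover have "eventually (\<lambda>u. (f2 u / \<phi> u) / (f1 u / \<phi> u) = r) at_top"
    using eventually_ge_at_top[of N]
  proof eventually_elim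
    case (elim u) then show ?case using N(1)[of u] r[of u] by auto
  qed
  ultimately have "((\<lambda>_. r) \<longlongrightarrow> 1) (at_top :: real filter)" by (auto dest: Lim_transform_eventually)
  then have "r = 1" by (simp add: tendsto_const_iff)
  then have eqN: "f2 N = f1 N" "f1 N \<noteq> 0" using r[of N] N by auto
  then have eqN': "g2 N = g1 N" using w0[of N] N z by auto
  \<comment> \<open>The difference has zero value and zero derivative at \<open>N\<close>, so it
    vanishes back to z, whatever zeros \<open>f1\<close> has in between.\<close>
  have "f1 z - f2 z = 0"
  proof (rule linear_ode_zero_backwards[where h = "\<lambda>z. f1 z - f2 z" and k = "\<lambda>z. g1 z - g2 z" and q = q and b = N])
    fix u assume "u \<in> {z..N}"
    then have u: "u > a" using z by auto
    show "((\<lambda>z. f1 z - f2 z) has_vector_derivative g1 u - g2 u) (at u)"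
      using f1[OF u] f2[OF u] by (auto intro!: derivative_eq_intros)
    show "((\<lambda>z. g1 z - g2 z) has_vector_derivative q u * (f1 u - f2 u)) (at u)"
      using g1[OF u] g2[OF u] by (auto intro!: derivative_eq_intros simp: algebra_simps)
  next
    show "continuous_on {z..N} q" by (rule continuous_on_subset[OF q]) (use z in auto)
  qed (use eqN eqN' N in auto)
  then show ?thesis by simp
qed

section \<open>Differentiation under the integral sign\<close>

lemma has_vector_derivative_iff_quotient:
  fixes f :: "real \<Rightarrow> 'a::real_normed_vector"
  shows "(f has_vector_derivative D) (at y) \<longleftrightarrow> ((\<lambda>u. (f u - f y) /\<^sub>R (u - y)) \<longlongrightarrow> D) (at y)"
proof -
  have "norm (f u - f y - (u - y) *\<^sub>R D) / norm (u - y) = norm ((f u - f y) /\<^sub>R (u - y) - D)" if "u \<noteq> y" for u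
  proof -
    have "(f u - f y) /\<^sub>R (u - y) - D = (f u - f y - (u - y) *\<^sub>R D) /\<^sub>R (u - y)"
      using that by (simp add: scaleR_diff_right)
    then show ?thesis by (simp add: divide_inverse mult.commute abs_inverse)
  qed
  then have "((\<lambda>u. norm (f u - f y - (u - y) *\<^sub>R D) / norm (u - y)) \<longlongrightarrow> 0) (at y) \<longleftrightarrow>
      ((\<lambda>u. norm ((f u - f y) /\<^sub>R (u - y) - D)) \<longlongrightarrow> 0) (at y)"
    by (intro tendsto_cong) (auto simp: eventually_at_filter)
  then show ?thesis
    by (simp add: has_vector_derivative_def has_derivative_iff_norm bounded_linear_scaleR_left tendsto_norm_zero_iff Lim_null[symmetric])
qed

text \<open>The mean value inequality turns the bound on the derivative into the same bound
  \<open>G\<close> on every difference quotient, so dominated convergence applies along each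
  sequence tending to y.\<close>

lemma has_vector_derivative_integral_dominated:
  fixes f f' :: "real \<Rightarrow> 'a \<Rightarrow> complex"
  assumes y: "a < y" "y < b"
    and d: "\<And>u s. u \<in> {a<..<b} \<Longrightarrow> ((\<lambda>u. f u s) has_vector_derivative f' u s) (at u)"
    and int: "\<And>u. u \<in> {a<..<b} \<Longrightarrow> integrable M (f u)"
    and bound: "\<And>u s. u \<in> {a<..<b} \<Longrightarrow> norm (f' u s) \<le> G s"
    and G: "integrable M G" and meas: "f' y \<in> borel_measurable M"
  shows "((\<lambda>u. \<integral>s. f u s \<partial>M) has_vector_derivative (\<integral>s. f' y s \<partial>M)) (at y)"
proof -
  define Q where "Q = (\<lambda>u s. (f u s - f y s) /\<^sub>R (u - y))"
  have lim: "((\<lambda>u. \<integral>s. Q u s \<partial>M) \<longlongrightarrow> (\<integral>s. f' y s \<partial>M)) (at y)"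
    unfolding tendsto_at_iff_sequentially
  proof (intro allI impI, unfold o_def)
    fix X :: "nat \<Rightarrow> real" assume X: "\<forall>i. X i \<in> UNIV - {y}" "X \<longlonglongrightarrow> y"
    have "eventually (\<lambda>i. X i \<in> {a<..<b}) sequentially"
      using X(2) y by (intro topological_tendstoD) auto
    then obtain n0 where n0: "\<And>i. i \<ge> n0 \<Longrightarrow> X i \<in> {a<..<b}" by (auto simp: eventually_sequentially)
    show "(\<lambda>i. \<integral>s. Q (X i) s \<partial>M) \<longlonglongrightarrow> (\<integral>s. f' y s \<partial>M)"
    proof (rule LIMSEQ_offset[of _ n0], rule integral_dominated_convergence[where w = G])
      show "f' y \<in> borel_measurable M" "integrable M G" by fact+
      show "Q (X (i + n0)) \<in> borel_measurable M" for i
        unfolding Q_def using int[of "X (i + n0)"] int[of y] n0[of "i + n0"] y by auto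
      show "AE s in M. (\<lambda>i. Q (X (i + n0)) s) \<longlonglongrightarrow> f' y s"
      proof (intro AE_I2)
        fix s
        have "((\<lambda>u. Q u s) \<longlongrightarrow> f' y s) (at y)"
          using d[of y s] y unfolding Q_def by (simp add: has_vector_derivative_iff_quotient)
        then have "(\<lambda>i. Q (X i) s) \<longlonglongrightarrow> f' y s"
          using X unfolding tendsto_at_iff_sequentially o_def by blast
        then show "(\<lambda>i. Q (X (i + n0)) s) \<longlonglongrightarrow> f' y s" by (rule LIMSEQ_ignore_initial_segment)
      qed
      show "AE s in M. norm (Q (X (i + n0)) s) \<le> G s" for i
      proof (intro AE_I2)
        fix s
        let ?x = "X (i + n0)"
        have "norm (f ?x s - f y s) \<le> G s * \<bar>?x - y\<bar>"
          using d bound n0[of "i + n0"] y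
          by (intro has_vector_derivative_bound[of "{a<..<b}" _ "\<lambda>u. f' u s"]) auto
        then show "norm (Q ?x s) \<le> G s"
          using X(1) by (auto simp: Q_def divide_simps norm_divide)
      qed
    qed
  qed
  have "eventually (\<lambda>u. u \<in> {a<..<b}) (at y)"
    using y by (intro eventually_at_in_open') auto
  then have "eventually (\<lambda>u. (\<integral>s. Q u s \<partial>M) = ((\<integral>s. f u s \<partial>M) - (\<integral>s. f y s \<partial>M)) /\<^sub>R (u - y)) (at y)"
    by eventually_elim (use int y in \<open>auto simp: Q_def\<close>)
  then have "((\<lambda>u. ((\<integral>s. f u s \<partial>M) - (\<integral>s. f y s \<partial>M)) /\<^sub>R (u - y)) \<longlongrightarrow> (\<integral>s. f' y s \<partial>M)) (at y)"
    using lim by (auto dest: Lim_transform_eventually)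
  then show ?thesis
    by (simp add: has_vector_derivative_iff_quotient)
qed

section \<open>The parabolic cylinder function\<close>

lemma of_real_powr_eq_exp_ln:
  assumes "t > 0"
  shows "complex_of_real t powr p = exp (p * of_real (ln t))"
  using assms by (simp add: powr_def Ln_of_real)

lemma norm_of_real_powr:
  assumes "t > 0"
  shows "norm (complex_of_real t powr p) = t powr Re p"
  using assms by (simp add: norm_powr_real_powr)

lemma has_vector_derivative_of_real_powr:
  assumes "t > 0"
  shows "((\<lambda>t. complex_of_real t powr p) has_vector_derivative p * of_real t powr (p - 1)) (at t)"
proof (rule has_vector_derivative_real_field)
  show "((\<lambda>w. w powr p) has_field_derivative p * of_real t powr (p - 1)) (at (of_real t))"
    using assms by (intro has_field_derivative_powr) auto
qed

lemma has_vector_derivative_exp_of_real: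
  assumes "(f has_real_derivative D) (at t)"
  shows "((\<lambda>t. complex_of_real (exp (f t))) has_vector_derivative of_real (D * exp (f t))) (at t)"
proof -
  have "((\<lambda>t. exp (f t)) has_real_derivative D * exp (f t)) (at t)"
    using assms by (auto intro!: derivative_eq_intros)
  then show ?thesis
    by (intro has_vector_derivative_of_real) (simp add: has_real_derivative_iff_has_vector_derivative)
qed

section \<open>Integral representation for negative real part of the order\<close>

definition weber_integrand :: "complex \<Rightarrow> real \<Rightarrow> real \<Rightarrow> complex" where
  "weber_integrand r z t = of_real t powr r * of_real (exp (- t\<^sup>2 / 2 - z * t))"

text \<open>Here p stands for -\<mu>. The exponent p - 1 makes this a Gamma integral with an extra
  Gaussian, and differentiation in z, which multiplies the integrand by -t, just shifts p by
  one.\<close>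

definition weber_integral :: "complex \<Rightarrow> real \<Rightarrow> complex" where
  "weber_integral p z = (\<integral>t. indicator {0<..} t *\<^sub>R weber_integrand (p - 1) z t \<partial>lborel)"

lemma continuous_on_weber_integrand: "continuous_on {0<..} (weber_integrand r z)"
  unfolding weber_integrand_def by (intro continuous_intros) auto

lemma weber_integrand_measurable:
  "(\<lambda>t. indicator {0<..} t *\<^sub>R weber_integrand r z t) \<in> borel_measurable lborel"
  using borel_measurable_continuous_on_indicator[OF _ continuous_on_weber_integrand] by simp

lemma
  assumes "Re p > 0"
  shows integrable_Gamma_integrand:
      "integrable lborel (\<lambda>t. indicator {0<..} t *\<^sub>R (complex_of_real t powr (p - 1) / of_real (exp t)))"
    and integral_Gamma_integrand:
      "(\<integral>t. indicator {0<..} t *\<^sub>R (complex_of_real t powr (p - 1) / of_real (exp t)) \<partial>lborel) = Gamma p"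
proof -
  let ?f = "\<lambda>t. indicator {0<..} t *\<^sub>R (complex_of_real t powr (p - 1) / of_real (exp t))"
  have "continuous_on {0<..} (\<lambda>t. complex_of_real t powr (p - 1) / of_real (exp t))"
    by (intro continuous_intros) auto
  from borel_measurable_continuous_on_indicator[OF _ this]
  have "?f \<in> borel_measurable lborel" by simp
  then show int: "integrable lborel ?f"
    using absolutely_integrable_Gamma_integral'[OF assms] by (simp add: set_integrable_def integrable_completion)
  have "?f = (\<lambda>t. if t \<in> {0<..} then complex_of_real t powr (p - 1) / of_real (exp t) else 0)"
    by (auto simp: fun_eq_iff)
  then have "(?f has_integral Gamma p) UNIV"
    using Gamma_integral_complex'[OF assms] by (simp only: has_integral_restrict_UNIV)
  then show "integral\<^sup>L lborel ?f = Gamma p"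
    using has_integral_integral_lborel[OF int] has_integral_unique by blast
qed

text \<open>Expanding 0 \<le> (t - (Z + 1))^2 trades the Gaussian for exp (-t) and leaves the Gamma
  integrand. Being uniform in |z| \<le> Z, the bound gives one majorant for a whole neighbourhood of
  a point.\<close>

lemma norm_weber_integrand_le:
  assumes "\<bar>z\<bar> \<le> Z"
  shows "norm (indicator {0<..} t *\<^sub>R weber_integrand r z t)
    \<le> exp ((Z + 1)\<^sup>2 / 2) * norm (indicator {0<..} t *\<^sub>R (complex_of_real t powr r / of_real (exp t)))"
proof (cases "t > 0")
  case True
  have "- (z * t) \<le> Z * t"
    using True assms by (metis abs_le_iff minus_mult_left mult_right_mono less_imp_le)
  moreover have "0 \<le> (t - (Z + 1))\<^sup>2" by simp
  ultimately have "- t\<^sup>2 / 2 - z * t \<le> (Z + 1)\<^sup>2 / 2 - t"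
    by (simp add: power2_eq_square algebra_simps)
  then have "exp (- t\<^sup>2 / 2 - z * t) \<le> exp ((Z + 1)\<^sup>2 / 2) / exp t"
    by (simp flip: exp_diff)
  then have "t powr Re r * exp (- t\<^sup>2 / 2 - z * t) \<le> t powr Re r * (exp ((Z + 1)\<^sup>2 / 2) / exp t)"
    by (intro mult_left_mono) auto
  then show ?thesis
    using True by (simp add: weber_integrand_def norm_mult norm_divide norm_of_real_powr mult_ac del: of_real_exp)
qed auto

lemma integrable_weber_integrand:
  assumes "Re p > 0"
  shows "integrable lborel (\<lambda>t. indicator {0<..} t *\<^sub>R weber_integrand (p - 1) z t)"
proof (rule Bochner_Integration.integrable_bound)
  show "integrable lborel (\<lambda>t. exp ((\<bar>z\<bar> + 1)\<^sup>2 / 2) *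
      norm (indicator {0<..} t *\<^sub>R (complex_of_real t powr (p - 1) / of_real (exp t))))"
    using integrable_Gamma_integrand[OF assms] by (intro integrable_mult_right integrable_norm)
  show "AE t in lborel. norm (indicator {0<..} t *\<^sub>R weber_integrand (p - 1) z t)
      \<le> norm (exp ((\<bar>z\<bar> + 1)\<^sup>2 / 2) * norm (indicator {0<..} t *\<^sub>R (complex_of_real t powr (p - 1) / of_real (exp t))))"
    using norm_weber_integrand_le[of z "\<bar>z\<bar>"] by (intro AE_I2) (simp del: of_real_exp norm_scaleR)
qed (rule weber_integrand_measurable)

lemma weber_integral_deriv:
  assumes "Re p > 0"
  shows "(weber_integral p has_vector_derivative - weber_integral (p + 1) z) (at z)"
proof -
  \<comment> \<open>The first 1 is the radius of the neighbourhood of z, the second comes from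
    completing the square.\<close>
  let ?G = "\<lambda>t. exp ((\<bar>z\<bar> + 1 + 1)\<^sup>2 / 2) * norm (indicator {0<..} t *\<^sub>R (complex_of_real t powr p / of_real (exp t)))"
  have "((\<lambda>z. \<integral>t. indicator {0<..} t *\<^sub>R weber_integrand (p - 1) z t \<partial>lborel) has_vector_derivative
      (\<integral>t. - (indicator {0<..} t *\<^sub>R weber_integrand p z t) \<partial>lborel)) (at z)"
  proof (rule has_vector_derivative_integral_dominated[of "z - 1" _ "z + 1" _ "\<lambda>z t. - (indicator {0<..} t *\<^sub>R weber_integrand p z t)" _ ?G])
    show "integrable lborel ?G"
      using integrable_Gamma_integrand[of "p + 1"] assms by (intro integrable_mult_right integrable_norm) auto
    fix u t assume u: "u \<in> {z-1<..<z+1}"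
    show "norm (- (indicator {0<..} t *\<^sub>R weber_integrand p u t)) \<le> ?G t"
    proof -
      have "\<bar>u\<bar> \<le> \<bar>z\<bar> + 1" using u by auto
      from norm_weber_integrand_le[OF this, of t p] show ?thesis by (simp del: of_real_exp norm_scaleR)
    qed
    have "((\<lambda>z. complex_of_real (exp (- t\<^sup>2 / 2 - z * t))) has_vector_derivative of_real (- t * exp (- t\<^sup>2 / 2 - u * t))) (at u)"
      by (rule has_vector_derivative_exp_of_real) (auto intro!: derivative_eq_intros)
    then have "((\<lambda>z. weber_integrand (p - 1) z t) has_vector_derivative
        of_real t powr (p - 1) * of_real (- t * exp (- t\<^sup>2 / 2 - u * t))) (at u)"
      unfolding weber_integrand_def by (rule has_vector_derivative_mult_right)
    then have "((\<lambda>z. indicator {0<..} t *\<^sub>R weber_integrand (p - 1) z t) has_vector_derivative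
        indicator {0<..} t *\<^sub>R (of_real t powr (p - 1) * of_real (- t * exp (- t\<^sup>2 / 2 - u * t)))) (at u)"
      using bounded_linear.has_vector_derivative[OF bounded_linear_scaleR_right] by blast
    also have "indicator {0<..} t *\<^sub>R (of_real t powr (p - 1) * of_real (- t * exp (- t\<^sup>2 / 2 - u * t))) =
        - (indicator {0<..} t *\<^sub>R weber_integrand p u t)"
      by (auto simp: indicator_def weber_integrand_def powr_diff)
    finally show "((\<lambda>z. indicator {0<..} t *\<^sub>R weber_integrand (p - 1) z t) has_vector_derivative
        - (indicator {0<..} t *\<^sub>R weber_integrand p u t)) (at u)" .
  next
    show "(\<lambda>t. - (indicator {0<..} t *\<^sub>R weber_integrand p z t)) \<in> borel_measurable lborel"
      using weber_integrand_measurable by (rule borel_measurable_uminus)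
  qed (use integrable_weber_integrand[OF assms] in auto)
  then show ?thesis unfolding weber_integral_def[abs_def] by simp
qed

text \<open>The derivative of t^p exp (- t^2 / 2 - z t) integrates to 0; the boundary value at 0
  vanishes because Re p > 0. As differentiation shifts p, this amounts to I'' = z I' + p I, which
  becomes Weber's equation after multiplication by exp (- z^2 / 4).\<close>

lemma weber_integral_recurrence:
  assumes "Re p > 0"
  shows "weber_integral (p + 2) z = p * weber_integral p z - of_real z * weber_integral (p + 1) z"
proof -
  let ?f = "\<lambda>t. p * weber_integrand (p - 1) z t - weber_integrand (p + 1) z t - of_real z * weber_integrand p z t"
  let ?i = "\<lambda>r t. indicator {0<..} t *\<^sub>R weber_integrand r z t"
  have i: "integrable lborel (?i (p - 1))" "integrable lborel (?i p)" "integrable lborel (?i (p + 1))"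
    using integrable_weber_integrand[of p] integrable_weber_integrand[of "p + 1"]
      integrable_weber_integrand[of "p + 2"] assms by (auto simp: algebra_simps)
  have split: "indicator {0<..} t *\<^sub>R ?f t = p * ?i (p - 1) t - ?i (p + 1) t - of_real z * ?i p t" for t
    by (simp add: indicator_def)
  have lim: "((\<lambda>t. t powr Re p * exp (- t\<^sup>2 / 2 - z * t)) \<longlongrightarrow> 0) at_top"
    by real_asymp
  have lim0: "((\<lambda>t. t powr Re p * exp (- t\<^sup>2 / 2 - z * t)) \<longlongrightarrow> 0) (at_right 0)"
    using assms by real_asymp
  have "(LBINT t=0..\<infinity>. ?f t) = 0 - 0"
  proof (rule interval_integral_FTC_integrable[where F = "weber_integrand p z"])
    fix t assume "0 < ereal t"
    then have t: "t > 0" by simp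
    have "((\<lambda>t. complex_of_real (exp (- t\<^sup>2 / 2 - z * t))) has_vector_derivative of_real ((- t - z) * exp (- t\<^sup>2 / 2 - z * t))) (at t)"
      by (rule has_vector_derivative_exp_of_real) (auto intro!: derivative_eq_intros)
    from has_vector_derivative_mult[OF has_vector_derivative_of_real_powr[OF t] this]
    have "(weber_integrand p z has_vector_derivative of_real t powr p * of_real ((- t - z) * exp (- t\<^sup>2 / 2 - z * t)) +
        p * of_real t powr (p - 1) * of_real (exp (- t\<^sup>2 / 2 - z * t))) (at t)"
      unfolding weber_integrand_def[abs_def] .
    also have "of_real t powr p * of_real ((- t - z) * exp (- t\<^sup>2 / 2 - z * t)) +
        p * of_real t powr (p - 1) * of_real (exp (- t\<^sup>2 / 2 - z * t)) = ?f t"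
      using t by (simp add: weber_integrand_def powr_add algebra_simps del: of_real_exp)
    finally show "(weber_integrand p z has_vector_derivative ?f t) (at t)" .
    have "continuous_on {0<..} ?f"
      by (intro continuous_intros continuous_on_weber_integrand)
    then show "isCont ?f t" using t by (simp add: continuous_on_eq_continuous_at)
  next
    have "einterval 0 \<infinity> = {0<..}" by (auto simp: einterval_def)
    moreover have "integrable lborel (\<lambda>t. indicator {0<..} t *\<^sub>R ?f t)"
      unfolding split using i by (intro Bochner_Integration.integrable_diff integrable_mult_right)
    ultimately show "set_integrable lborel (einterval 0 \<infinity>) ?f"
      by (simp add: set_integrable_def)
    show "((weber_integrand p z \<circ> real_of_ereal) \<longlongrightarrow> 0) (at_right 0)"
    proof -
      have "(weber_integrand p z \<longlongrightarrow> 0) (at_right 0)"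
      proof (rule tendsto_norm_zero_cancel, rule Lim_transform_eventually[OF lim0])
        show "eventually (\<lambda>t. t powr Re p * exp (- t\<^sup>2 / 2 - z * t) = norm (weber_integrand p z t)) (at_right 0)"
          using eventually_at_right_less[of "0::real"]
          by eventually_elim (simp add: weber_integrand_def norm_mult norm_of_real_powr del: of_real_exp)
      qed
      then show ?thesis by (simp add: zero_ereal_def ereal_tendsto_simps)
    qed
    show "((weber_integrand p z \<circ> real_of_ereal) \<longlongrightarrow> 0) (at_left \<infinity>)"
    proof -
      have "(weber_integrand p z \<longlongrightarrow> 0) at_top"
      proof (rule tendsto_norm_zero_cancel, rule Lim_transform_eventually[OF lim])
        show "eventually (\<lambda>t. t powr Re p * exp (- t\<^sup>2 / 2 - z * t) = norm (weber_integrand p z t)) at_top"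
          using eventually_gt_at_top[of "0::real"]
          by eventually_elim (simp add: weber_integrand_def norm_mult norm_of_real_powr del: of_real_exp)
      qed
      then show ?thesis by (simp add: ereal_tendsto_simps)
    qed
  qed auto
  moreover have "(LBINT t=0..\<infinity>. ?f t) = (\<integral>t. indicator {0<..} t *\<^sub>R ?f t \<partial>lborel)"
    by (simp add: interval_lebesgue_integral_0_infty set_lebesgue_integral_def)
  moreover have "\<dots> = p * weber_integral p z - weber_integral (p + 2) z - of_real z * weber_integral (p + 1) z"
  proof -
    have "(\<integral>t. p * A t - B t - of_real z * C t \<partial>lborel) = p * integral\<^sup>L lborel A - integral\<^sup>L lborel B - of_real z * integral\<^sup>L lborel C"
      if "integrable lborel A" "integrable lborel B" "integrable lborel C" for A B C :: "real \<Rightarrow> complex"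
      using that by simp
    from this[OF i(1,3,2)]
    have "(\<integral>t. indicator {0<..} t *\<^sub>R ?f t \<partial>lborel) = p * integral\<^sup>L lborel (?i (p - 1)) - integral\<^sup>L lborel (?i (p + 1)) - of_real z * integral\<^sup>L lborel (?i p)"
      unfolding split .
    then show ?thesis by (simp add: weber_integral_def algebra_simps)
  qed
  ultimately show ?thesis by (simp add: algebra_simps)
qed

text \<open>Substituting t / z for t cancels the power of z and leaves t^(p-1) exp (- t - (t / z)^2
  / 2). This tends pointwise to the Gamma integrand and is dominated by it.\<close>

lemma weber_integral_asymp:
  assumes "Re p > 0"
  shows "((\<lambda>z. of_real z powr p * weber_integral p z) \<longlongrightarrow> Gamma p) at_top"
proof -
  let ?g = "\<lambda>t. indicator {0<..} t *\<^sub>R (complex_of_real t powr (p - 1) / of_real (exp t))"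
  let ?h = "\<lambda>z t. indicator {0<..} t *\<^sub>R (complex_of_real t powr (p - 1) * of_real (exp (- (t / z)\<^sup>2 / 2 - t)))"
  have "((\<lambda>z. \<integral>t. ?h z t \<partial>lborel) \<longlongrightarrow> (\<integral>t. ?g t \<partial>lborel)) at_top"
  proof (rule integral_dominated_convergence_at_top[where w = "\<lambda>t. norm (?g t)"])
    show "?g \<in> borel_measurable lborel" using integrable_Gamma_integrand[OF assms] by auto
    have "continuous_on {0<..} (\<lambda>t. complex_of_real t powr (p - 1) * of_real (exp (- (t / z)\<^sup>2 / 2 - t)))" for z
      unfolding divide_inverse by (intro continuous_intros) auto
    from borel_measurable_continuous_on_indicator[OF _ this]
    show "?h z \<in> borel_measurable lborel" for z by simp
    show "integrable lborel (\<lambda>t. norm (?g t))"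
      using integrable_Gamma_integrand[OF assms] by (rule integrable_norm)
    show "eventually (\<lambda>z. AE t in lborel. norm (?h z t) \<le> norm (?g t)) at_top"
    proof (intro always_eventually allI AE_I2)
      fix z t :: real
      have "exp (- (t / z)\<^sup>2 / 2 - t) \<le> exp (- t)" by simp
      then have "exp (- (t / z)\<^sup>2 / 2 - t) \<le> 1 / exp t" by (simp only: exp_minus inverse_eq_divide)
      from mult_left_mono[OF this norm_ge_zero[of "complex_of_real t powr (p - 1)"]]
      show "norm (?h z t) \<le> norm (?g t)"
        by (cases "t > 0") (auto simp only: indicator_simps greaterThan_iff norm_scaleR norm_mult norm_divide norm_of_real abs_exp_cancel times_divide_eq_right mult_1_right mult_1 mult_zero_left not_less abs_0 abs_1 order_refl)
    qed
    show "AE t in lborel. ((\<lambda>z. ?h z t) \<longlongrightarrow> ?g t) at_top"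
    proof (intro AE_I2)
      fix t :: real
      have "((\<lambda>z. exp (- (t / z)\<^sup>2 / 2 - t)) \<longlongrightarrow> exp (- t)) at_top"
      proof -
        have "((\<lambda>z. t / z) \<longlongrightarrow> 0) at_top"
          by (rule real_tendsto_divide_at_top[OF tendsto_const filterlim_ident])
        then have "((\<lambda>z. exp (- (t / z)\<^sup>2 / 2 - t)) \<longlongrightarrow> exp (- 0\<^sup>2 / 2 - t)) at_top"
          by (intro tendsto_intros) auto
        then show ?thesis by simp
      qed
      then have "((\<lambda>z. ?h z t) \<longlongrightarrow> indicator {0<..} t *\<^sub>R (complex_of_real t powr (p - 1) * of_real (exp (- t)))) at_top"
        by (intro tendsto_scaleR tendsto_mult tendsto_const tendsto_of_real)
      then show "((\<lambda>z. ?h z t) \<longlongrightarrow> ?g t) at_top"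
        by (simp only: exp_minus of_real_inverse divide_inverse)
    qed
  qed
  moreover have "eventually (\<lambda>z. (\<integral>t. ?h z t \<partial>lborel) = of_real z powr p * weber_integral p z) at_top"
    using eventually_gt_at_top[of 0]
  proof eventually_elim
    case (elim z)
    have "weber_integral p z = (1 / z) *\<^sub>R (\<integral>t. indicator {0<..} (t / z) *\<^sub>R weber_integrand (p - 1) z (t / z) \<partial>lborel)"
      unfolding weber_integral_def
      using elim by (subst lborel_integral_real_affine[where c = "1 / z" and t = 0]) auto
    also have "of_real z powr p * \<dots> = (\<integral>t. of_real z powr p * ((1 / z) *\<^sub>R indicator {0<..} (t / z) *\<^sub>R weber_integrand (p - 1) z (t / z)) \<partial>lborel)"
      by (simp only: integral_mult_right_zero Bochner_Integration.integral_scaleR_right)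
    also have "\<dots> = (\<integral>t. ?h z t \<partial>lborel)"
    proof (intro Bochner_Integration.integral_cong refl)
      fix t :: real
      show "of_real z powr p * ((1 / z) *\<^sub>R indicator {0<..} (t / z) *\<^sub>R weber_integrand (p - 1) z (t / z)) = ?h z t"
      proof (cases "t > 0")
        case True
        have "complex_of_real (t / z) powr (p - 1) = of_real t powr (p - 1) / of_real z powr (p - 1)"
          using True elim by (simp add: of_real_powr_eq_exp_ln ln_div ring_distribs exp_diff del: of_real_divide)
        then show ?thesis using True elim
          by (simp add: weber_integrand_def powr_diff scaleR_conv_of_real field_simps del: of_real_exp)
      qed (use elim in \<open>auto simp: zero_less_divide_iff\<close>)
    qed
    finally show ?case by simp
  qed
  ultimately show ?thesis
    using integral_Gamma_integrand[OF assms] by (simp add: Lim_transform_eventually)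
qed


lemma has_vector_derivative_of_real_mult:
  fixes f :: "real \<Rightarrow> complex"
  assumes "(f has_vector_derivative D) (at z)"
  shows "((\<lambda>z. of_real z * f z) has_vector_derivative (f z + of_real z * D)) (at z)"
  using has_vector_derivative_mult[OF has_vector_derivative_of_real[OF DERIV_ident] assms]
  by (simp add: add.commute)

definition weber_gauge :: "complex \<Rightarrow> real \<Rightarrow> complex" where
  "weber_gauge \<mu> z = exp (- of_real (z\<^sup>2 / 4)) * of_real z powr \<mu>"

lemma weber_gauge_add1: "z > 0 \<Longrightarrow> weber_gauge (\<mu> + 1) z = of_real z * weber_gauge \<mu> z"
  by (simp add: weber_gauge_def powr_add)

lemma weber_gauge_nonzero: "z > 0 \<Longrightarrow> weber_gauge \<mu> z \<noteq> 0"
  by (simp add: weber_gauge_def)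

lemma norm_weber_gauge: "z > 0 \<Longrightarrow> norm (weber_gauge \<mu> z) = exp (- z\<^sup>2 / 4) * z powr Re \<mu>"
  by (simp add: weber_gauge_def norm_mult norm_of_real_powr)

lemma power_mult_weber_gauge_tendsto_0:
  "((\<lambda>z. of_real (z ^ k) * weber_gauge \<mu> z) \<longlongrightarrow> 0) at_top"
proof (rule tendsto_norm_zero_cancel, rule Lim_transform_eventually)
  show "((\<lambda>z. z powr real k * (exp (- z\<^sup>2 / 4) * z powr Re \<mu>)) \<longlongrightarrow> 0) at_top"
    by real_asymp
  show "eventually (\<lambda>z. z powr real k * (exp (- z\<^sup>2 / 4) * z powr Re \<mu>) = norm (of_real (z ^ k) * weber_gauge \<mu> z)) at_top"
    using eventually_gt_at_top[of 0]
    by eventually_elim (simp add: norm_mult norm_weber_gauge norm_power powr_realpow)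
qed

section \<open>Existence for every order by raising\<close>

text \<open>The last conjunct is not part of the definition of \<open>parabolic_D\<close>. It makes
  the predicate inductive: in z f / 2 - g both terms have the same leading order, so the limit of
  the raised function also requires that of \<open>g\<close>.\<close>

definition is_weber_recessive :: "complex \<Rightarrow> (real \<Rightarrow> complex) \<Rightarrow> (real \<Rightarrow> complex) \<Rightarrow> bool" where
  "is_weber_recessive \<mu> f g \<longleftrightarrow>
     (\<forall>z. (f has_vector_derivative g z) (at z)) \<and>
     (\<forall>z. (g has_vector_derivative ((of_real (z\<^sup>2 / 4) - \<mu> - 1/2) * f z)) (at z)) \<and>
     ((\<lambda>z. f z / weber_gauge \<mu> z) \<longlongrightarrow> 1) at_top \<and>
     ((\<lambda>z. g z / (of_real z * weber_gauge \<mu> z)) \<longlongrightarrow> - 1 / 2) at_top"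

lemma weber_recessive_exists_neg:
  assumes "Re \<mu> < 0"
  shows "\<exists>f g. is_weber_recessive \<mu> f g"
proof -
  define p where "p = - \<mu>"
  have p: "Re p > 0" "Re (p + 1) > 0" using assms by (auto simp: p_def)
  have mu: "\<mu> = - p" by (simp add: p_def)
  have c: "Gamma p \<noteq> 0"
    using p by (auto simp: Gamma_eq_zero_iff nonpos_Ints_def)
  define e where "e = (\<lambda>z::real. complex_of_real (exp (- z\<^sup>2 / 4)))"
  let ?I = "\<lambda>k. weber_integral (p + k)"
  define f where "f = (\<lambda>z. e z * weber_integral p z / Gamma p)"
  define g where "g = (\<lambda>z. e z * (- ?I 1 z - of_real z * weber_integral p z / 2) / Gamma p)"
  have e': "(e has_vector_derivative - of_real z / 2 * e z) (at z)" for z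
    unfolding e_def
    by (rule has_vector_derivative_eq_rhs, rule has_vector_derivative_exp_of_real)
       (auto intro!: derivative_eq_intros simp del: of_real_exp)
  have I0: "(weber_integral p has_vector_derivative - ?I 1 z) (at z)" for z
    using weber_integral_deriv[OF p(1)] .
  have I1: "(?I 1 has_vector_derivative - ?I 2 z) (at z)" for z
    using weber_integral_deriv[OF p(2), of z] by (simp add: add.assoc)
  have f': "(f has_vector_derivative g z) (at z)" for z
    unfolding f_def
    by (rule has_vector_derivative_eq_rhs, (rule has_vector_derivative_divide has_vector_derivative_mult e' I0)+)
       (simp add: g_def algebra_simps divide_simps)
  have g': "(g has_vector_derivative ((of_real (z\<^sup>2 / 4) - \<mu> - 1/2) * f z)) (at z)" for z
    unfolding g_def
    by (rule has_vector_derivative_eq_rhs,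
        (rule has_vector_derivative_divide has_vector_derivative_of_real_mult has_vector_derivative_mult
          has_vector_derivative_diff has_vector_derivative_minus e' I0 I1)+)
       (simp only: weber_integral_recurrence[OF p(1)], use c in \<open>simp add: f_def mu field_simps power2_eq_square\<close>)
  have e_gauge: "e z / weber_gauge \<mu> z = of_real z powr p" if "z > 0" for z
    using that by (simp add: e_def weber_gauge_def p_def powr_minus field_simps exp_minus flip: exp_of_real)
  have fl: "((\<lambda>z. f z / weber_gauge \<mu> z) \<longlongrightarrow> 1) at_top"
  proof (rule Lim_transform_eventually)
    show "((\<lambda>z. of_real z powr p * weber_integral p z / Gamma p) \<longlongrightarrow> 1) at_top"
      using tendsto_divide[OF weber_integral_asymp[OF p(1)] tendsto_const c] c by simp
    show "eventually (\<lambda>z. of_real z powr p * weber_integral p z / Gamma p = f z / weber_gauge \<mu> z) at_top"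
      using eventually_gt_at_top[of 0]
      by eventually_elim (simp add: f_def e_gauge[symmetric])
  qed
  \<comment> \<open>Since z^(p+1) I_(p+1) has a finite limit, its contribution is smaller by z^(-2).
    The limit - 1/2 comes from the derivative of the Gaussian factor alone.\<close>
  have "((\<lambda>z. g z / (of_real z * weber_gauge \<mu> z)) \<longlongrightarrow> - 1 / 2) at_top"
  proof (rule Lim_transform_eventually)
    have "((\<lambda>z::real. complex_of_real (1 / z\<^sup>2)) \<longlongrightarrow> of_real 0) at_top"
      by (intro tendsto_of_real) real_asymp
    from tendsto_mult[OF this weber_integral_asymp[OF p(2)]]
    have "((\<lambda>z. of_real (1 / z\<^sup>2) * (of_real z powr (p + 1) * ?I 1 z)) \<longlongrightarrow> 0) at_top" by simp
    from tendsto_diff[OF tendsto_minus[OF tendsto_divide[OF this tendsto_const c]] tendsto_divide[OF fl tendsto_const]]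
    show "((\<lambda>z. - (of_real (1 / z\<^sup>2) * (of_real z powr (p + 1) * ?I 1 z) / Gamma p) - (f z / weber_gauge \<mu> z) / 2) \<longlongrightarrow> - 1 / 2) at_top"
      by simp
    show "eventually (\<lambda>z. - (of_real (1 / z\<^sup>2) * (of_real z powr (p + 1) * ?I 1 z) / Gamma p) - (f z / weber_gauge \<mu> z) / 2 =
       g z / (of_real z * weber_gauge \<mu> z)) at_top"
      using eventually_gt_at_top[of 0]
    proof eventually_elim
      case (elim z)
      then have "of_real z powr (p + 1) = of_real z * (e z / weber_gauge \<mu> z)"
        by (simp add: e_gauge powr_add)
      then show ?case using elim c weber_gauge_nonzero[OF elim, of \<mu>]
        by (simp add: f_def g_def field_simps power2_eq_square)
    qed
  qed
  with f' g' fl show ?thesis unfolding is_weber_recessive_def by blast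
qed

text \<open>Weber's equation turns f1' into (\<mu> + 1) f - z f1 / 2, the companion lowering
  relation. This form is easy to differentiate again and shows the asymptotics: 1/2 - (- 1/2) = 1
  for \<open>f1\<close>, while \<open>f\<close> is smaller than z f1 by a factor of order z^(-2),
  leaving - 1/2 for the derivative.\<close>

lemma weber_recessive_raise:
  assumes "is_weber_recessive \<mu> f g"
  defines "f1 \<equiv> \<lambda>z. of_real z * f z / 2 - g z"
  shows "is_weber_recessive (\<mu> + 1) f1 (\<lambda>z. (\<mu> + 1) * f z - of_real z * f1 z / 2)"
proof -
  have f: "(f has_vector_derivative g z) (at z)"
    and g: "(g has_vector_derivative ((of_real (z\<^sup>2 / 4) - \<mu> - 1/2) * f z)) (at z)" for z
    using assms by (auto simp: is_weber_recessive_def)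
  have fl: "((\<lambda>z. f z / weber_gauge \<mu> z) \<longlongrightarrow> 1) at_top"
    and gl: "((\<lambda>z. g z / (of_real z * weber_gauge \<mu> z)) \<longlongrightarrow> - 1 / 2) at_top"
    using assms by (auto simp: is_weber_recessive_def)
  let ?g1 = "\<lambda>z. (\<mu> + 1) * f z - of_real z * f1 z / 2"
  have f1': "(f1 has_vector_derivative ?g1 z) (at z)" for z
    unfolding f1_def
    by (rule has_vector_derivative_eq_rhs,
        (rule has_vector_derivative_divide has_vector_derivative_diff has_vector_derivative_of_real_mult f g)+)
       (simp add: field_simps power2_eq_square)
  have g1': "(?g1 has_vector_derivative ((of_real (z\<^sup>2 / 4) - (\<mu> + 1) - 1/2) * f1 z)) (at z)" for z
    by (rule has_vector_derivative_eq_rhs,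
        (rule has_vector_derivative_divide has_vector_derivative_diff has_vector_derivative_of_real_mult
           has_vector_derivative_mult_right f f1')+)
       (simp add: f1_def field_simps power2_eq_square)
  have f1l: "((\<lambda>z. f1 z / weber_gauge (\<mu> + 1) z) \<longlongrightarrow> 1) at_top"
  proof (rule Lim_transform_eventually)
    show "((\<lambda>z. (f z / weber_gauge \<mu> z) / 2 - g z / (of_real z * weber_gauge \<mu> z)) \<longlongrightarrow> 1) at_top"
      using tendsto_diff[OF tendsto_divide[OF fl tendsto_const[of 2]] gl] by simp
    show "eventually (\<lambda>z. (f z / weber_gauge \<mu> z) / 2 - g z / (of_real z * weber_gauge \<mu> z) = f1 z / weber_gauge (\<mu> + 1) z) at_top"
      using eventually_gt_at_top[of 0]
      by eventually_elim (simp only: weber_gauge_add1, simp add: f1_def weber_gauge_nonzero field_simps)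
  qed
  have "((\<lambda>z. ?g1 z / (of_real z * weber_gauge (\<mu> + 1) z)) \<longlongrightarrow> - 1 / 2) at_top"
  proof (rule Lim_transform_eventually)
    have "((\<lambda>z::real. complex_of_real (1 / z\<^sup>2)) \<longlongrightarrow> of_real 0) at_top"
      by (intro tendsto_of_real) real_asymp
    from tendsto_mult[OF this fl]
    have "((\<lambda>z. of_real (1 / z\<^sup>2) * (f z / weber_gauge \<mu> z)) \<longlongrightarrow> 0) at_top" by simp
    from tendsto_diff[OF tendsto_mult[OF tendsto_const[of "\<mu> + 1"] this] tendsto_divide[OF f1l tendsto_const[of 2]]]
    show "((\<lambda>z. (\<mu> + 1) * (of_real (1 / z\<^sup>2) * (f z / weber_gauge \<mu> z)) - f1 z / weber_gauge (\<mu> + 1) z / 2) \<longlongrightarrow> - 1 / 2) at_top"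
      by simp
    show "eventually (\<lambda>z. (\<mu> + 1) * (of_real (1 / z\<^sup>2) * (f z / weber_gauge \<mu> z)) - f1 z / weber_gauge (\<mu> + 1) z / 2 =
       ?g1 z / (of_real z * weber_gauge (\<mu> + 1) z)) at_top"
      using eventually_gt_at_top[of 0]
      by eventually_elim (simp only: weber_gauge_add1, simp add: weber_gauge_nonzero field_simps power2_eq_square)
  qed
  with f1' g1' f1l show ?thesis unfolding is_weber_recessive_def by blast
qed

lemma weber_recessive_exists: "\<exists>f g. is_weber_recessive \<mu> f g"
proof -
  \<comment> \<open>At most n raisings lead from the half-plane of negative real part to
    \<mu>.\<close>
  have "\<exists>f g. is_weber_recessive \<mu> f g" if "Re \<mu> < real n" for n
    using that
  proof (induction n arbitrary: \<mu>)
    case 0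
    then show ?case using weber_recessive_exists_neg by simp
  next
    case (Suc n)
    then obtain f g where "is_weber_recessive (\<mu> - 1) f g" by fastforce
    from weber_recessive_raise[OF this] show ?case by auto
  qed
  then show ?thesis using reals_Archimedean2[of "Re \<mu>"] by blast
qed

lemma parabolic_D_eqI:
  assumes "is_weber_recessive \<mu> f g"
  shows "parabolic_D \<mu> = f"
  unfolding parabolic_D_def
proof (rule the_equality)
  have f: "\<And>z. (f has_vector_derivative g z) (at z)"
    and g: "\<And>z. (g has_vector_derivative ((of_real (z\<^sup>2 / 4) - \<mu> - 1/2) * f z)) (at z)"
    and fl: "((\<lambda>z. f z / weber_gauge \<mu> z) \<longlongrightarrow> 1) at_top"
    using assms by (auto simp: is_weber_recessive_def)
  show "(\<exists>g. (\<forall>z. (f has_vector_derivative g z) (at z)) \<and>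
          (\<forall>z. (g has_vector_derivative ((of_real (z\<^sup>2 / 4) - \<mu> - 1/2) * f z)) (at z))) \<and>
     ((\<lambda>z. f z / (exp (- of_real (z\<^sup>2 / 4)) * of_real z powr \<mu>)) \<longlongrightarrow> 1) at_top"
    using f g fl unfolding weber_gauge_def by blast
  fix h assume "(\<exists>g. (\<forall>z. (h has_vector_derivative g z) (at z)) \<and>
          (\<forall>z. (g has_vector_derivative ((of_real (z\<^sup>2 / 4) - \<mu> - 1/2) * h z)) (at z))) \<and>
     ((\<lambda>z. h z / (exp (- of_real (z\<^sup>2 / 4)) * of_real z powr \<mu>)) \<longlongrightarrow> 1) at_top"
  then obtain k where h: "\<And>z. (h has_vector_derivative k z) (at z)"
    and k: "\<And>z. (k has_vector_derivative ((of_real (z\<^sup>2 / 4) - \<mu> - 1/2) * h z)) (at z)"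
    and hl: "((\<lambda>z. h z / weber_gauge \<mu> z) \<longlongrightarrow> 1) at_top"
    unfolding weber_gauge_def by blast
  have gauge: "(weber_gauge \<mu> \<longlongrightarrow> 0) at_top"
    using power_mult_weber_gauge_tendsto_0[of 0 \<mu>] by simp
  have "((\<lambda>z. of_real (z ^ 2) * weber_gauge \<mu> z / 4 - (\<mu> + 1/2) * weber_gauge \<mu> z) \<longlongrightarrow> 0 / 4 - (\<mu> + 1/2) * 0) at_top"
    by (intro tendsto_diff tendsto_divide tendsto_mult tendsto_const gauge power_mult_weber_gauge_tendsto_0) auto
  then have q: "((\<lambda>z. (of_real (z\<^sup>2 / 4) - \<mu> - 1/2) * weber_gauge \<mu> z) \<longlongrightarrow> 0) at_top"
    by (simp add: algebra_simps)
  \<comment> \<open>Uniqueness holds on half-lines, so every real z is treated with its own left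
    endpoint z - 1.\<close>
  show "h = f"
  proof
    fix z
    show "h z = f z"
    proof (rule recessive_solution_unique[OF h k f g hl fl gauge q])
      show "z - 1 < z" by simp
      show "continuous_on {z - 1<..} (\<lambda>z. complex_of_real (z\<^sup>2 / 4) - \<mu> - 1/2)"
        by (intro continuous_intros) auto
    qed
  qed
qed

lemma parabolic_D_obtain:
  obtains D' where "is_weber_recessive \<mu> (parabolic_D \<mu>) D'"
proof -
  obtain f g where "is_weber_recessive \<mu> f g" using weber_recessive_exists by blast
  then show ?thesis using that[of g] parabolic_D_eqI by simp
qed

section \<open>Integrals against \<open>cosh (s / 2)\<close>\<close>

lemma has_vector_derivative_chain_real:
  fixes f :: "real \<Rightarrow> complex"
  assumes "(y has_real_derivative d) (at z)" "(f has_vector_derivative D) (at (y z))"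
  shows "((\<lambda>z. f (y z)) has_vector_derivative of_real d * D) (at z)"
  using vector_diff_chain_at[of y d z f D] assms
  by (simp add: has_real_derivative_iff_has_vector_derivative o_def scaleR_conv_of_real)

lemma bounded_on_nonneg_if_tendsto_0:
  fixes h :: "real \<Rightarrow> complex"
  assumes "continuous_on UNIV h" "(h \<longlongrightarrow> 0) at_top"
  shows "\<exists>C. \<forall>u\<ge>0. norm (h u) \<le> C"
proof -
  have "eventually (\<lambda>u. norm (h u) < 1) at_top"
    using assms(2) by (auto simp: tendsto_iff dest: spec[of _ 1])
  then obtain N where N: "\<And>u. u \<ge> N \<Longrightarrow> norm (h u) < 1" by (auto simp: eventually_at_top_linorder)
  have "bounded (h ` {0..N})"
    by (intro compact_imp_bounded compact_continuous_image compact_Icc continuous_on_subset[OF assms(1)]) auto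
  then obtain B where B: "\<And>u. u \<in> {0..N} \<Longrightarrow> norm (h u) \<le> B" unfolding bounded_iff by (metis imageI)
  have "norm (h u) \<le> max B 1" if "u \<ge> 0" for u
    using N[of u] B[of u] that by (cases "u \<le> N") (auto simp: max_def)
  then show ?thesis by blast
qed

definition damped_D :: "complex \<Rightarrow> real \<Rightarrow> complex" where
  "damped_D \<alpha> u = of_real (exp (- u\<^sup>2 / 4)) * parabolic_D (2 * \<alpha>) u"

text \<open>One constant and one Gaussian rate serve F, F' and F''. The rate 1/8 is half of the 1/4
  in \<open>damped_D\<close>; the other half pays for the factor u in F''. The restriction to u
  \<ge> 0 suits the arguments y cosh (s / 2), and \<open>parabolic_D\<close> need not be bounded on
  the negative axis.\<close>

lemma damped_D_obtain:
  obtains F' C where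
    "\<And>u. (damped_D \<alpha> has_vector_derivative F' u) (at u)"
    "\<And>u. (F' has_vector_derivative - of_real u * F' u - (2 * \<alpha> + 1) * damped_D \<alpha> u) (at u)"
    "\<And>u. u \<ge> 0 \<Longrightarrow> norm (damped_D \<alpha> u) \<le> C * exp (- u\<^sup>2 / 8)"
    "\<And>u. u \<ge> 0 \<Longrightarrow> norm (F' u) \<le> C * exp (- u\<^sup>2 / 8)"
    "\<And>u. u \<ge> 0 \<Longrightarrow> norm (- of_real u * F' u - (2 * \<alpha> + 1) * damped_D \<alpha> u) \<le> C * exp (- u\<^sup>2 / 8)"
proof -
  let ?\<mu> = "2 * \<alpha>"
  let ?D = "parabolic_D ?\<mu>"
  obtain D' where D': "is_weber_recessive ?\<mu> ?D D'" by (rule parabolic_D_obtain)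
  have d1: "(?D has_vector_derivative D' z) (at z)"
    and d2: "(D' has_vector_derivative ((of_real (z\<^sup>2 / 4) - ?\<mu> - 1/2) * ?D z)) (at z)" for z
    using D' by (auto simp: is_weber_recessive_def)
  have l1: "((\<lambda>z. ?D z / weber_gauge ?\<mu> z) \<longlongrightarrow> 1) at_top"
    and l2: "((\<lambda>z. D' z / (of_real z * weber_gauge ?\<mu> z)) \<longlongrightarrow> - 1 / 2) at_top"
    using D' by (auto simp: is_weber_recessive_def)
  \<comment> \<open>F' is exp (- u^2 / 4) times \<open>E\<close>, and the limits for both D and D'
    make \<open>E\<close> tend to 0, so it is bounded for u \<ge> 0.\<close>
  define E where "E = (\<lambda>u. D' u - of_real u * ?D u / 2)"
  define e where "e = (\<lambda>z::real. complex_of_real (exp (- z\<^sup>2 / 4)))"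
  define F' where "F' = (\<lambda>u. e u * E u)"
  have e': "(e has_vector_derivative - of_real z / 2 * e z) (at z)" for z
    unfolding e_def
    by (rule has_vector_derivative_eq_rhs, rule has_vector_derivative_exp_of_real)
       (auto intro!: derivative_eq_intros simp del: of_real_exp)
  have damped_eq: "damped_D \<alpha> = (\<lambda>u. e u * ?D u)" by (simp add: fun_eq_iff damped_D_def e_def)
  have E': "(E has_vector_derivative (of_real (z\<^sup>2 / 4) - ?\<mu> - 1/2) * ?D z - (?D z + of_real z * D' z) / 2) (at z)" for z
    unfolding E_def
    by (rule has_vector_derivative_diff has_vector_derivative_divide has_vector_derivative_of_real_mult d1 d2)+
  have F1: "(damped_D \<alpha> has_vector_derivative F' u) (at u)" for u
    unfolding damped_eq
    by (rule has_vector_derivative_eq_rhs, rule has_vector_derivative_mult[OF e' d1])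
       (simp add: F'_def E_def algebra_simps)
  have F2: "(F' has_vector_derivative - of_real u * F' u - (2 * \<alpha> + 1) * damped_D \<alpha> u) (at u)" for u
    unfolding F'_def
    by (rule has_vector_derivative_eq_rhs, rule has_vector_derivative_mult[OF e' E'])
       (simp add: damped_eq E_def field_simps power2_eq_square)
  have lim_gauge: "((\<lambda>z. of_real z * weber_gauge ?\<mu> z) \<longlongrightarrow> 0) at_top" "(weber_gauge ?\<mu> \<longlongrightarrow> 0) at_top"
    using power_mult_weber_gauge_tendsto_0[of 1 ?\<mu>] power_mult_weber_gauge_tendsto_0[of 0 ?\<mu>] by auto
  have limD: "(?D \<longlongrightarrow> 0) at_top"
  proof (rule Lim_transform_eventually)
    show "((\<lambda>z. ?D z / weber_gauge ?\<mu> z * weber_gauge ?\<mu> z) \<longlongrightarrow> 0) at_top"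
      using tendsto_mult[OF l1 lim_gauge(2)] by simp
    show "eventually (\<lambda>z. ?D z / weber_gauge ?\<mu> z * weber_gauge ?\<mu> z = ?D z) at_top"
      using eventually_gt_at_top[of 0] by eventually_elim (simp add: weber_gauge_nonzero)
  qed
  have limE: "(E \<longlongrightarrow> 0) at_top"
  proof (rule Lim_transform_eventually)
    show "((\<lambda>z. (D' z / (of_real z * weber_gauge ?\<mu> z) - ?D z / weber_gauge ?\<mu> z / 2) * (of_real z * weber_gauge ?\<mu> z)) \<longlongrightarrow> 0) at_top"
      using tendsto_mult[OF tendsto_diff[OF l2 tendsto_divide[OF l1 tendsto_const[of 2]]] lim_gauge(1)] by simp
    show "eventually (\<lambda>z. (D' z / (of_real z * weber_gauge ?\<mu> z) - ?D z / weber_gauge ?\<mu> z / 2) * (of_real z * weber_gauge ?\<mu> z) = E z) at_top"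
      using eventually_gt_at_top[of 0] by eventually_elim (simp add: weber_gauge_nonzero E_def field_simps)
  qed
  have "continuous_on UNIV ?D" "continuous_on UNIV E"
    using d1 E' by (auto intro!: continuous_at_imp_continuous_on has_vector_derivative_continuous)
  then obtain A B where A: "\<And>u. u \<ge> 0 \<Longrightarrow> norm (?D u) \<le> A" and B: "\<And>u. u \<ge> 0 \<Longrightarrow> norm (E u) \<le> B"
    using bounded_on_nonneg_if_tendsto_0[OF _ limD] bounded_on_nonneg_if_tendsto_0[OF _ limE] by metis
  have AB: "A \<ge> 0" "B \<ge> 0" using order_trans[OF norm_ge_zero A[of 0]] order_trans[OF norm_ge_zero B[of 0]] by auto
  \<comment> \<open>The 2 is the bound for u exp (- u^2 / 8); the last summand covers the multiple
    of F in F''.\<close>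
  define C where "C = A + 2 * B + norm (2 * \<alpha> + 1) * A"
  have exp_split: "exp (- u\<^sup>2 / 4) = exp (- u\<^sup>2 / 8) * exp (- u\<^sup>2 / 8)" for u :: real
    by (simp flip: exp_add)
  have exp_le: "exp (- u\<^sup>2 / 4) \<le> exp (- u\<^sup>2 / 8)" for u :: real by simp
  have u_exp: "u * exp (- u\<^sup>2 / 8) \<le> 2" for u :: real
  proof -
    have "u \<le> 2 * (1 + u\<^sup>2 / 8)"
      using zero_le_power2[of "u / 2 - 1"] by (simp add: power2_eq_square algebra_simps)
    also have "\<dots> \<le> 2 * exp (u\<^sup>2 / 8)" by (intro mult_left_mono exp_ge_add_one_self) simp
    finally show ?thesis by (simp add: exp_minus field_simps)
  qed
  have bF: "norm (damped_D \<alpha> u) \<le> A * exp (- u\<^sup>2 / 8)" if "u \<ge> 0" for u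
    using mult_mono[OF exp_le[of u] A[OF that]] by (simp add: damped_D_def norm_mult mult.commute del: of_real_exp)
  have bF': "norm (F' u) \<le> B * exp (- u\<^sup>2 / 8)" if "u \<ge> 0" for u
    using mult_mono[OF exp_le[of u] B[OF that]] by (simp add: F'_def e_def norm_mult mult.commute del: of_real_exp)
  have buF': "norm (of_real u * F' u) \<le> 2 * B * exp (- u\<^sup>2 / 8)" if "u \<ge> 0" for u
  proof -
    have "norm (of_real u * F' u) = (u * exp (- u\<^sup>2 / 8)) * (norm (E u) * exp (- u\<^sup>2 / 8))"
      using that exp_split[of u] by (simp add: F'_def e_def norm_mult del: of_real_exp)
    also have "\<dots> \<le> 2 * (B * exp (- u\<^sup>2 / 8))"
      using B[OF that] AB that by (intro mult_mono u_exp) auto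
    finally show ?thesis by simp
  qed
  show thesis
  proof (rule that[of F' C, OF F1 F2])
    fix u :: real assume u: "u \<ge> 0"
    have C: "A \<le> C" "B \<le> C" using AB by (auto simp: C_def)
    show "norm (damped_D \<alpha> u) \<le> C * exp (- u\<^sup>2 / 8)"
      by (rule order_trans[OF bF[OF u] mult_right_mono[OF C(1)]]) simp
    show "norm (F' u) \<le> C * exp (- u\<^sup>2 / 8)"
      by (rule order_trans[OF bF'[OF u] mult_right_mono[OF C(2)]]) simp
    have "norm (- of_real u * F' u - (2 * \<alpha> + 1) * damped_D \<alpha> u) \<le>
        norm (of_real u * F' u) + norm (2 * \<alpha> + 1) * norm (damped_D \<alpha> u)"
      using norm_triangle_ineq4[of "- of_real u * F' u" "(2 * \<alpha> + 1) * damped_D \<alpha> u"] by (simp add: norm_mult)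
    also have "\<dots> \<le> 2 * B * exp (- u\<^sup>2 / 8) + norm (2 * \<alpha> + 1) * (A * exp (- u\<^sup>2 / 8))"
      by (intro add_mono mult_left_mono buF' bF u) auto
    also have "\<dots> \<le> C * exp (- u\<^sup>2 / 8)"
      using AB by (simp add: C_def algebra_simps)
    finally show "norm (- of_real u * F' u - (2 * \<alpha> + 1) * damped_D \<alpha> u) \<le> C * exp (- u\<^sup>2 / 8)" .
  qed
qed

section \<open>Gaussian majorants and derivatives of the cosh integrals\<close>

text \<open>Half of \<delta> s^2 absorbs L |s| at the cost of the constant exp (L^2 / (2 \<delta>));
  the other half is the exponent of a normal density with standard deviation 1 / sqrt
  \<delta>.\<close>

lemma integrable_exp_abs_minus_square:
  fixes L \<delta> :: real
  assumes "\<delta> > 0"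
  shows "integrable lborel (\<lambda>s. exp (L * \<bar>s\<bar> - \<delta> * s\<^sup>2))"
proof (rule Bochner_Integration.integrable_bound)
  let ?\<sigma> = "1 / sqrt \<delta>"
  show "integrable lborel (\<lambda>s. exp (L\<^sup>2 / (2 * \<delta>)) * sqrt (2 * pi * ?\<sigma>\<^sup>2) * normal_density 0 ?\<sigma> s)"
    using assms by (intro integrable_mult_right integrable_normal_density) simp
  show "AE s in lborel. norm (exp (L * \<bar>s\<bar> - \<delta> * s\<^sup>2))
     \<le> norm (exp (L\<^sup>2 / (2 * \<delta>)) * sqrt (2 * pi * ?\<sigma>\<^sup>2) * normal_density 0 ?\<sigma> s)"
  proof (intro AE_I2)
    fix s :: real
    have "0 \<le> (\<delta> * \<bar>s\<bar> - L)\<^sup>2 / (2 * \<delta>)" using assms by simp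
    then have "L * \<bar>s\<bar> - \<delta> * s\<^sup>2 \<le> L\<^sup>2 / (2 * \<delta>) + - (\<delta> * s\<^sup>2 / 2)"
      using assms by (simp add: power2_eq_square field_simps)
    then have "exp (L * \<bar>s\<bar> - \<delta> * s\<^sup>2) \<le> exp (L\<^sup>2 / (2 * \<delta>)) * exp (- (\<delta> * s\<^sup>2 / 2))"
      by (simp only: exp_add[symmetric] exp_le_cancel_iff)
    also have "\<dots> = exp (L\<^sup>2 / (2 * \<delta>)) * sqrt (2 * pi * ?\<sigma>\<^sup>2) * normal_density 0 ?\<sigma> s"
      using assms by (simp add: normal_density_def power_divide real_sqrt_divide field_simps)
    finally show "norm (exp (L * \<bar>s\<bar> - \<delta> * s\<^sup>2))
       \<le> norm (exp (L\<^sup>2 / (2 * \<delta>)) * sqrt (2 * pi * ?\<sigma>\<^sup>2) * normal_density 0 ?\<sigma> s)"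
      by simp
  qed
qed auto

lemma cosh_ge_quadratic: "1 + x\<^sup>2 / 4 \<le> cosh (x::real)"
proof -
  have "1 + \<bar>x\<bar> + \<bar>x\<bar>\<^sup>2 / 2 \<le> exp \<bar>x\<bar>" by (rule exp_lower_Taylor_quadratic) simp
  moreover have "1 - \<bar>x\<bar> \<le> exp (- \<bar>x\<bar>)" using exp_ge_add_one_self[of "- \<bar>x\<bar>"] by simp
  ultimately have "1 + x\<^sup>2 / 4 \<le> cosh \<bar>x\<bar>" by (simp add: cosh_def)
  then show ?thesis by simp
qed

lemma cosh_le_exp_abs: "cosh (x::real) \<le> exp \<bar>x\<bar>"
proof -
  have "exp (- \<bar>x\<bar>) \<le> exp \<bar>x\<bar>" by simp
  then have "cosh \<bar>x\<bar> \<le> exp \<bar>x\<bar>" by (simp add: cosh_def)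
  then show ?thesis by simp
qed

text \<open>This replaces the doubly exponential decay of a Gaussian in cosh (s / 2) by a Gaussian
  in s, which already beats every factor exp (L |s|).\<close>

lemma cosh_half_square_ge: "s\<^sup>2 / 4 \<le> (cosh (s / 2 :: real))\<^sup>2"
proof -
  have "\<bar>s / 2\<bar> \<le> 1 + (s / 2)\<^sup>2 / 4"
    using zero_le_power2[of "1 - \<bar>s\<bar> / 4"] by (simp add: power2_eq_square algebra_simps)
  also have "\<dots> \<le> cosh (s / 2)" by (rule cosh_ge_quadratic)
  finally show ?thesis using power_mono[of "\<bar>s / 2\<bar>" "cosh (s / 2)" 2] by (simp add: power_divide)
qed

text \<open>The power k accounts for derivatives in y: each one differentiates \<open>\<Phi>\<close>
  and brings down a factor cosh (s / 2). Thus J, J', J'' have k = 0, 1, 2 with F, F', F'' for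
  \<open>\<Phi>\<close>.\<close>

definition cosh_integrand :: "complex \<Rightarrow> nat \<Rightarrow> (real \<Rightarrow> complex) \<Rightarrow> real \<Rightarrow> real \<Rightarrow> complex" where
  "cosh_integrand \<nu> k \<Phi> y s = exp (\<nu> * of_real s) * of_real (cosh (s / 2) ^ k) * \<Phi> (y * cosh (s / 2))"

definition cosh_integral :: "complex \<Rightarrow> nat \<Rightarrow> (real \<Rightarrow> complex) \<Rightarrow> real \<Rightarrow> complex" where
  "cosh_integral \<nu> k \<Phi> y = (\<integral>s. cosh_integrand \<nu> k \<Phi> y s \<partial>lborel)"

lemma norm_exp_mult_of_real_le: "norm (exp (\<nu> * complex_of_real s)) \<le> exp (norm \<nu> * \<bar>s\<bar>)"
  using norm_exp[of "\<nu> * complex_of_real s"] by (simp add: norm_mult)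

text \<open>The 32 is 8 from the decay of \<open>\<Phi>\<close> times 4 from cosh^2 (s / 2) \<ge>
  s^2 / 4. The bound depends on y only through a lower bound a, as domination near a point
  requires.\<close>

lemma norm_cosh_integrand_le:
  assumes \<Phi>: "\<And>u. u \<ge> 0 \<Longrightarrow> norm (\<Phi> u) \<le> C * exp (- u\<^sup>2 / 8)" and y: "0 < a" "a \<le> y"
  shows "norm (cosh_integrand \<nu> k \<Phi> y s) \<le> C * exp ((norm \<nu> + real k) * \<bar>s\<bar> - a\<^sup>2 / 32 * s\<^sup>2)"
proof -
  let ?c = "cosh (s / 2)"
  have C: "C \<ge> 0" using order_trans[OF norm_ge_zero \<Phi>[of 0]] by simp
  have "a\<^sup>2 * (s\<^sup>2 / 4) \<le> y\<^sup>2 * ?c\<^sup>2"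
    using y by (intro mult_mono cosh_half_square_ge power_mono) auto
  then have "exp (- (y * ?c)\<^sup>2 / 8) \<le> exp (- (a\<^sup>2 / 32 * s\<^sup>2))"
    by (simp add: power_mult_distrib)
  then have 1: "norm (\<Phi> (y * ?c)) \<le> C * exp (- (a\<^sup>2 / 32 * s\<^sup>2))"
    using \<Phi>[of "y * ?c"] y mult_left_mono[OF _ C] by (smt (verit) cosh_real_nonneg mult_nonneg_nonneg)
  have "?c \<le> exp \<bar>s\<bar>" using cosh_le_exp_abs[of "s / 2"] by (rule order_trans) simp
  then have "?c ^ k \<le> exp \<bar>s\<bar> ^ k" by (intro power_mono) auto
  then have 2: "?c ^ k \<le> exp (real k * \<bar>s\<bar>)" by (simp add: exp_of_nat_mult)
  have "norm (cosh_integrand \<nu> k \<Phi> y s) = norm (exp (\<nu> * of_real s)) * ?c ^ k * norm (\<Phi> (y * ?c))"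
    by (simp add: cosh_integrand_def norm_mult norm_power)
  also have "\<dots> \<le> exp (norm \<nu> * \<bar>s\<bar>) * exp (real k * \<bar>s\<bar>) * (C * exp (- (a\<^sup>2 / 32 * s\<^sup>2)))"
    using C by (intro mult_mono norm_exp_mult_of_real_le 1 2) auto
  also have "\<dots> = C * exp ((norm \<nu> + real k) * \<bar>s\<bar> - a\<^sup>2 / 32 * s\<^sup>2)"
  proof -
    have "exp ((norm \<nu> + real k) * \<bar>s\<bar> - a\<^sup>2 / 32 * s\<^sup>2) = exp (norm \<nu> * \<bar>s\<bar> + real k * \<bar>s\<bar> + - (a\<^sup>2 / 32 * s\<^sup>2))"
      by (simp add: distrib_right)
    then show ?thesis by (simp only: exp_add mult_ac)
  qed
  finally show ?thesis .
qed

lemma continuous_on_cosh_integrand: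
  assumes "continuous_on UNIV \<Phi>"
  shows "continuous_on UNIV (cosh_integrand \<nu> k \<Phi> y)"
  unfolding cosh_integrand_def
  by (intro continuous_intros continuous_on_compose2[OF assms]) auto

lemma cosh_integrand_measurable:
  assumes "continuous_on UNIV \<Phi>"
  shows "cosh_integrand \<nu> k \<Phi> y \<in> borel_measurable lborel"
  using borel_measurable_continuous_onI[OF continuous_on_cosh_integrand[OF assms]] by simp

lemma integrable_cosh_integrand:
  assumes cont: "continuous_on UNIV \<Phi>"
    and \<Phi>: "\<And>u. u \<ge> 0 \<Longrightarrow> norm (\<Phi> u) \<le> C * exp (- u\<^sup>2 / 8)" and y: "0 < y"
  shows "integrable lborel (cosh_integrand \<nu> k \<Phi> y)"
proof (rule Bochner_Integration.integrable_bound)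
  show "integrable lborel (\<lambda>s. C * exp ((norm \<nu> + real k) * \<bar>s\<bar> - y\<^sup>2 / 32 * s\<^sup>2))"
    using y by (intro integrable_mult_right integrable_exp_abs_minus_square) simp
  show "AE s in lborel. norm (cosh_integrand \<nu> k \<Phi> y s) \<le> norm (C * exp ((norm \<nu> + real k) * \<bar>s\<bar> - y\<^sup>2 / 32 * s\<^sup>2))"
    using norm_cosh_integrand_le[OF \<Phi> y order_refl, of \<nu> k]
    unfolding real_norm_def by (intro AE_I2 order_trans[OF _ abs_ge_self])
qed (rule cosh_integrand_measurable[OF cont])

lemma cosh_integral_deriv:
  assumes \<Phi>': "\<And>u. (\<Phi> has_vector_derivative \<Psi> u) (at u)" and cont: "continuous_on UNIV \<Psi>"
    and \<Phi>: "\<And>u. u \<ge> 0 \<Longrightarrow> norm (\<Phi> u) \<le> C * exp (- u\<^sup>2 / 8)"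
    and \<Psi>: "\<And>u. u \<ge> 0 \<Longrightarrow> norm (\<Psi> u) \<le> C * exp (- u\<^sup>2 / 8)" and y: "0 < y"
  shows "(cosh_integral \<nu> k \<Phi> has_vector_derivative cosh_integral \<nu> (Suc k) \<Psi> y) (at y)"
  unfolding cosh_integral_def[abs_def]
proof (rule has_vector_derivative_integral_dominated[of "y / 2" _ "y + 1"])
  have cont\<Phi>: "continuous_on UNIV \<Phi>"
    using \<Phi>' by (auto intro!: continuous_at_imp_continuous_on has_vector_derivative_continuous)
  \<comment> \<open>The rate is taken at y / 2, the left end of the interval. It degenerates at 0,
    so the interval must keep away from 0.\<close>
  show "integrable lborel (\<lambda>s. C * exp ((norm \<nu> + real (Suc k)) * \<bar>s\<bar> - (y / 2)\<^sup>2 / 32 * s\<^sup>2))"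
    using y by (intro integrable_mult_right integrable_exp_abs_minus_square) simp
  fix u s assume u: "u \<in> {y / 2<..<y + 1}"
  show "integrable lborel (cosh_integrand \<nu> k \<Phi> u)"
    using u y by (intro integrable_cosh_integrand[OF cont\<Phi> \<Phi>]) auto
  show "norm (cosh_integrand \<nu> (Suc k) \<Psi> u s) \<le> C * exp ((norm \<nu> + real (Suc k)) * \<bar>s\<bar> - (y / 2)\<^sup>2 / 32 * s\<^sup>2)"
    using u y by (intro norm_cosh_integrand_le \<Psi>) auto
  have "((\<lambda>u. \<Phi> (u * cosh (s / 2))) has_vector_derivative of_real (cosh (s / 2)) * \<Psi> (u * cosh (s / 2))) (at u)"
    by (rule has_vector_derivative_chain_real[OF _ \<Phi>']) (auto intro!: derivative_eq_intros)
  from has_vector_derivative_mult_right[OF this, of "exp (\<nu> * of_real s) * of_real (cosh (s / 2) ^ k)"]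
  show "((\<lambda>u. cosh_integrand \<nu> k \<Phi> u s) has_vector_derivative cosh_integrand \<nu> (Suc k) \<Psi> u s) (at u)"
    by (simp add: cosh_integrand_def mult_ac)
qed (use y cosh_integrand_measurable[OF cont] in auto)

lemma cosh_integrand_tendsto_0:
  assumes \<Phi>: "\<And>u. u \<ge> 0 \<Longrightarrow> norm (\<Phi> u) \<le> C * exp (- u\<^sup>2 / 8)" and y: "0 < y"
  shows "(cosh_integrand \<nu> k \<Phi> y \<longlongrightarrow> 0) at_top" "(cosh_integrand \<nu> k \<Phi> y \<longlongrightarrow> 0) at_bot"
proof -
  define L where "L = norm \<nu> + real k"
  define \<delta> where "\<delta> = y\<^sup>2 / 32"
  have "\<delta> > 0" using y by (simp add: \<delta>_def)
  then have "((\<lambda>s. C * exp (L * s - \<delta> * s\<^sup>2)) \<longlongrightarrow> C * 0) at_top"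
    by (intro tendsto_mult tendsto_const) real_asymp
  then have g: "((\<lambda>s. C * exp (L * s - \<delta> * s\<^sup>2)) \<longlongrightarrow> 0) at_top" by simp
  have b: "norm (cosh_integrand \<nu> k \<Phi> y s) \<le> C * exp (L * \<bar>s\<bar> - \<delta> * s\<^sup>2)" for s
    unfolding L_def \<delta>_def by (rule norm_cosh_integrand_le[OF \<Phi> y order_refl])
  show "(cosh_integrand \<nu> k \<Phi> y \<longlongrightarrow> 0) at_top"
  proof (rule Lim_null_comparison[OF _ g])
    show "eventually (\<lambda>s. norm (cosh_integrand \<nu> k \<Phi> y s) \<le> C * exp (L * s - \<delta> * s\<^sup>2)) at_top"
      using eventually_ge_at_top[of 0]
    proof eventually_elim
      case (elim s) then show ?case using b[of s] by simp
    qed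
  qed
  show "(cosh_integrand \<nu> k \<Phi> y \<longlongrightarrow> 0) at_bot"
    unfolding filterlim_at_bot_mirror
  proof (rule Lim_null_comparison[OF _ g])
    show "eventually (\<lambda>s. norm (cosh_integrand \<nu> k \<Phi> y (- s)) \<le> C * exp (L * s - \<delta> * s\<^sup>2)) at_top"
      using eventually_ge_at_top[of 0]
    proof eventually_elim
      case (elim s) then show ?case using b[of "- s"] by simp
    qed
  qed
qed

lemma abs_sinh_le_cosh: "\<bar>sinh (x::real)\<bar> \<le> cosh x"
  by (simp add: sinh_def cosh_def abs_le_iff)

text \<open>Integration by parts twice in \<open>s\<close>, using \<open>sinh\<^sup>2 = cosh\<^sup>2 - 1\<close> to stay within the family
  \<^const>\<open>cosh_integral\<close>.\<close>
lemma cosh_integral_by_parts: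
  assumes F1: "\<And>u. (F has_vector_derivative F1 u) (at u)" and F2: "\<And>u. (F1 has_vector_derivative F2 u) (at u)"
    and cont: "continuous_on UNIV F2"
    and b0: "\<And>u. u \<ge> 0 \<Longrightarrow> norm (F u) \<le> C * exp (- u\<^sup>2 / 8)"
    and b1: "\<And>u. u \<ge> 0 \<Longrightarrow> norm (F1 u) \<le> C * exp (- u\<^sup>2 / 8)"
    and b2: "\<And>u. u \<ge> 0 \<Longrightarrow> norm (F2 u) \<le> C * exp (- u\<^sup>2 / 8)" and y: "0 < y"
  shows "of_real (y\<^sup>2 / 4) * (cosh_integral \<nu> 2 F2 y - cosh_integral \<nu> 0 F2 y) + of_real (y / 4) * cosh_integral \<nu> 1 F1 y
    = \<nu>\<^sup>2 * cosh_integral \<nu> 0 F y"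
proof -
  have contF: "continuous_on UNIV F" "continuous_on UNIV F1"
    using F1 F2 by (auto intro!: continuous_at_imp_continuous_on has_vector_derivative_continuous)
  let ?I = "\<lambda>k \<Phi>. cosh_integrand \<nu> k \<Phi> y"
  \<comment> \<open>With G s = F (y cosh (s / 2)) this is exp (\<nu> s) (G' - \<nu> G), whose
    derivative is exp (\<nu> s) (G'' - \<nu>^2 G): both integrations by parts in one exact
    derivative.\<close>
  define H where "H = (\<lambda>s. exp (\<nu> * of_real s) * (of_real (y * sinh (s / 2) / 2) * F1 (y * cosh (s / 2)) - \<nu> * F (y * cosh (s / 2))))"
  define h where "h = (\<lambda>s. of_real (y\<^sup>2 / 4) * (?I 2 F2 s - ?I 0 F2 s) + of_real (y / 4) * ?I 1 F1 s - \<nu>\<^sup>2 * ?I 0 F s)"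
  have int: "integrable lborel (?I 2 F2)" "integrable lborel (?I 0 F2)" "integrable lborel (?I 1 F1)" "integrable lborel (?I 0 F)"
    using integrable_cosh_integrand cont contF b0 b1 b2 y by blast+
  have H': "(H has_vector_derivative h s) (at s)" for s
  proof -
    let ?sh = "sinh (s / 2)" and ?u = "y * cosh (s / 2)"
    have c': "((\<lambda>s. y * cosh (s / 2)) has_real_derivative y * ?sh / 2) (at s)"
      by (auto intro!: derivative_eq_intros)
    have s': "((\<lambda>s. of_real (y * sinh (s / 2) / 2)) has_vector_derivative complex_of_real (y * cosh (s / 2) / 4)) (at s)"
      by (rule has_vector_derivative_of_real) (auto intro!: derivative_eq_intros)
    have e': "((\<lambda>s. exp (\<nu> * of_real s)) has_vector_derivative \<nu> * exp (\<nu> * of_real s)) (at s)"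
      by (rule has_vector_derivative_real_field) (auto intro!: derivative_eq_intros)
    have sq: "complex_of_real ?sh * of_real ?sh = of_real (cosh (s / 2)) * of_real (cosh (s / 2)) - 1"
      unfolding of_real_mult[symmetric] using cosh_square_eq[of "s / 2"] by (simp add: power2_eq_square)
    have "(H has_vector_derivative exp (\<nu> * of_real s) *
          ((of_real (y * ?sh / 2) * (of_real (y * ?sh / 2) * F2 ?u) + of_real (y * cosh (s / 2) / 4) * F1 ?u)
            - \<nu> * (of_real (y * ?sh / 2) * F1 ?u)) +
        \<nu> * exp (\<nu> * of_real s) * (of_real (y * ?sh / 2) * F1 ?u - \<nu> * F ?u)) (at s)"
      unfolding H_def
      by (rule has_vector_derivative_mult has_vector_derivative_diff has_vector_derivative_mult_right e' s'
          has_vector_derivative_chain_real[OF c' F1] has_vector_derivative_chain_real[OF c' F2])+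
    also have "exp (\<nu> * of_real s) *
          ((of_real (y * ?sh / 2) * (of_real (y * ?sh / 2) * F2 ?u) + of_real (y * cosh (s / 2) / 4) * F1 ?u)
            - \<nu> * (of_real (y * ?sh / 2) * F1 ?u)) +
        \<nu> * exp (\<nu> * of_real s) * (of_real (y * ?sh / 2) * F1 ?u - \<nu> * F ?u) =
        exp (\<nu> * of_real s) * (of_real y * of_real y * (of_real ?sh * of_real ?sh) / 4 * F2 ?u
          + of_real (y * cosh (s / 2) / 4) * F1 ?u - \<nu> * \<nu> * F ?u)"
      by (simp add: field_simps)
    also have "\<dots> = h s"
      unfolding sq h_def cosh_integrand_def by (simp add: field_simps power2_eq_square)
    finally show ?thesis .
  qed
  have hint: "integrable lborel h"
    unfolding h_def using int by simp
  have "(LBINT s=-\<infinity>..\<infinity>. h s) = 0 - 0"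
  proof (rule interval_integral_FTC_integrable[where F = H])
    have "continuous_on UNIV h"
      unfolding h_def using cont contF by (intro continuous_intros continuous_on_cosh_integrand)
    then show "isCont h s" for s by (simp add: continuous_on_eq_continuous_at)
    show "set_integrable lborel (einterval (-\<infinity>) \<infinity>) h"
      using hint by (simp add: set_integrable_def)
    \<comment> \<open>Since |sinh| \<le> cosh, the boundary function is controlled by two members of
      the family, whose limits at both ends are known.\<close>
    have bound: "norm (H s) \<le> y / 2 * norm (?I 1 F1 s) + norm \<nu> * norm (?I 0 F s)" for s
    proof -
      have "norm (H s) \<le> norm (exp (\<nu> * of_real s)) * (y * \<bar>sinh (s / 2)\<bar> / 2 * norm (F1 (y * cosh (s / 2))) + norm \<nu> * norm (F (y * cosh (s / 2))))"
        unfolding H_def norm_mult[of "exp _"] using y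
        by (intro mult_left_mono norm_triangle_le_diff) (auto simp: norm_mult abs_mult)
      also have "\<dots> \<le> norm (exp (\<nu> * of_real s)) * (y * cosh (s / 2) / 2 * norm (F1 (y * cosh (s / 2))) + norm \<nu> * norm (F (y * cosh (s / 2))))"
        using y by (intro mult_left_mono add_right_mono mult_right_mono divide_right_mono abs_sinh_le_cosh) auto
      also have "\<dots> = y / 2 * norm (?I 1 F1 s) + norm \<nu> * norm (?I 0 F s)"
        by (simp add: cosh_integrand_def norm_mult algebra_simps)
      finally show ?thesis .
    qed
    have lim: "(H \<longlongrightarrow> 0) G" if "(?I 1 F1 \<longlongrightarrow> 0) G" "(?I 0 F \<longlongrightarrow> 0) G" for G
    proof (rule Lim_null_comparison[OF always_eventually])
      show "((\<lambda>s. y / 2 * norm (?I 1 F1 s) + norm \<nu> * norm (?I 0 F s)) \<longlongrightarrow> 0) G"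
        using tendsto_add[OF tendsto_mult[OF tendsto_const[of "y / 2"] tendsto_norm[OF that(1)]]
            tendsto_mult[OF tendsto_const[of "norm \<nu>"] tendsto_norm[OF that(2)]]] by simp
    qed (use bound in auto)
    show "((H \<circ> real_of_ereal) \<longlongrightarrow> 0) (at_right (- \<infinity>))"
      using lim[OF cosh_integrand_tendsto_0(2)[OF b1 y] cosh_integrand_tendsto_0(2)[OF b0 y]]
      by (simp add: ereal_tendsto_simps)
    show "((H \<circ> real_of_ereal) \<longlongrightarrow> 0) (at_left \<infinity>)"
      using lim[OF cosh_integrand_tendsto_0(1)[OF b1 y] cosh_integrand_tendsto_0(1)[OF b0 y]]
      by (simp add: ereal_tendsto_simps)
  qed (use H' in auto)
  moreover have "(LBINT s=-\<infinity>..\<infinity>. h s) = integral\<^sup>L lborel h"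
    by (simp add: interval_lebesgue_integral_def set_lebesgue_integral_def)
  moreover have "integral\<^sup>L lborel h = of_real (y\<^sup>2 / 4) * (cosh_integral \<nu> 2 F2 y - cosh_integral \<nu> 0 F2 y)
     + of_real (y / 4) * cosh_integral \<nu> 1 F1 y - \<nu>\<^sup>2 * cosh_integral \<nu> 0 F y"
    unfolding h_def cosh_integral_def using int by simp
  ultimately show ?thesis by simp
qed

section \<open>Laplace's method\<close>

lemma sinh_square_ge: "x\<^sup>2 / 2 \<le> (sinh (x::real))\<^sup>2"
proof -
  have "(1 + x\<^sup>2 / 4)\<^sup>2 \<le> (cosh x)\<^sup>2"
    by (intro power_mono cosh_ge_quadratic) auto
  moreover have "1 + x\<^sup>2 / 2 \<le> (1 + x\<^sup>2 / 4)\<^sup>2"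
    by (simp add: power2_sum)
  ultimately show ?thesis by (simp add: cosh_square_eq)
qed

lemma cosh_powr_le:
  fixes b x :: real
  shows "cosh x powr b \<le> exp (\<bar>b\<bar> * \<bar>x\<bar>)"
proof -
  have "cosh x powr b \<le> cosh x powr \<bar>b\<bar>"
    by (intro powr_mono) (auto simp: cosh_real_ge_1)
  also have "\<dots> \<le> exp \<bar>x\<bar> powr \<bar>b\<bar>"
    by (intro powr_mono2 cosh_le_exp_abs) auto
  also have "\<dots> = exp (\<bar>b\<bar> * \<bar>x\<bar>)" by (simp add: powr_def)
  finally show ?thesis .
qed

lemma tendsto_square_mult_sinh_square:
  fixes t :: real
  shows "((\<lambda>y. y\<^sup>2 * (sinh (t / y / 2))\<^sup>2) \<longlongrightarrow> (t / 2)\<^sup>2) at_top"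
proof -
  consider "t = 0" | "t > 0" | "t < 0" by linarith
  then show ?thesis
  proof cases
    case 2
    then show ?thesis unfolding sinh_field_def by real_asymp
  next
    case 3
    then show ?thesis unfolding sinh_field_def by real_asymp
  qed auto
qed

lemma integral_exp_minus_square_8: "(\<integral>t. complex_of_real (exp (- t\<^sup>2 / 8)) \<partial>lborel) = of_real (sqrt (8 * pi))"
proof -
  have "(\<integral>t. exp (- t\<^sup>2 / 8) \<partial>lborel) = (\<integral>t. sqrt (8 * pi) * normal_density 0 2 t \<partial>lborel)"
    by (intro Bochner_Integration.integral_cong refl) (simp add: normal_density_def field_simps)
  also have "\<dots> = sqrt (8 * pi)" by simp
  finally show ?thesis by (simp only: integral_complex_of_real)
qed

text \<open>Splits F into its leading term and a ratio tending to 1. The exponent u^2 / 2 collects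
  one u^2 / 4 from \<open>damped_D\<close> and one from \<open>weber_gauge\<close>.\<close>

lemma damped_D_eq:
  assumes "u > 0"
  shows "damped_D \<alpha> u = of_real (exp (- u\<^sup>2 / 2)) * of_real u powr (2 * \<alpha>) * (parabolic_D (2 * \<alpha>) u / weber_gauge (2 * \<alpha>) u)"
proof -
  have "exp (- u\<^sup>2 / 2) = exp (- u\<^sup>2 / 4) * exp (- u\<^sup>2 / 4)" by (simp flip: exp_add)
  moreover have "exp (- complex_of_real (u\<^sup>2 / 4)) = of_real (exp (- u\<^sup>2 / 4))" by (simp flip: exp_of_real)
  ultimately show ?thesis
    using assms by (simp add: damped_D_def weber_gauge_def del: of_real_exp)
qed

text \<open>Laplace's method: after the substitution \<open>s = t / y\<close> the integrand converges to \<open>exp (- t\<^sup>2 / 8)\<close>.\<close>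
lemma cosh_integral_damped_D_asymp:
  "((\<lambda>y. of_real y powr (1 - 2 * \<alpha>) * of_real (exp (y\<^sup>2 / 2)) * cosh_integral \<nu> 0 (damped_D \<alpha>) y)
     \<longlongrightarrow> of_real (sqrt (8 * pi))) at_top"
proof -
  obtain F' C where F': "\<And>u. (damped_D \<alpha> has_vector_derivative F' u) (at u)"
    by (rule damped_D_obtain[of \<alpha>]) blast
  then have cont: "continuous_on UNIV (damped_D \<alpha>)"
    by (auto intro!: continuous_at_imp_continuous_on has_vector_derivative_continuous)
  define R where "R = (\<lambda>u. parabolic_D (2 * \<alpha>) u / weber_gauge (2 * \<alpha>) u)"
  have R: "(R \<longlongrightarrow> 1) at_top"
    unfolding R_def using parabolic_D_obtain[of "2 * \<alpha>"] unfolding is_weber_recessive_def by metis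
  define h where "h = (\<lambda>y t. of_real y powr (1 - 2 * \<alpha>) * of_real (exp (y\<^sup>2 / 2)) * ((1 / y) *\<^sub>R cosh_integrand \<nu> 0 (damped_D \<alpha>) y (t / y)))"
  define L where "L = norm \<nu> + \<bar>Re \<alpha>\<bar>"
  \<comment> \<open>Write cosh^2 = 1 + sinh^2: the 1 cancels exp (y^2 / 2), and the powers of y
    cancel against the Jacobian 1 / y. Every remaining factor has a pointwise limit.\<close>
  have h_eq: "h y t = exp (\<nu> * of_real (t / y)) * R (y * cosh (t / y / 2)) * of_real (cosh (t / y / 2)) powr (2 * \<alpha>)
      * of_real (exp (- (y\<^sup>2 * (sinh (t / y / 2))\<^sup>2 / 2)))" if y: "y > 0" for y t
  proof -
    let ?c = "cosh (t / y / 2)"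
    have c: "?c > 0" by simp
    have eq1: "complex_of_real (y * ?c) powr (2 * \<alpha>) = of_real y powr (2 * \<alpha>) * of_real ?c powr (2 * \<alpha>)"
      using y c by (simp add: of_real_powr_eq_exp_ln ln_mult ring_distribs exp_add del: of_real_mult)
    have eq2: "complex_of_real y powr (1 - 2 * \<alpha>) * of_real y powr (2 * \<alpha>) = of_real y"
      using y by (simp flip: powr_add)
    have eq3: "exp (y\<^sup>2 / 2) * exp (- (y * ?c)\<^sup>2 / 2) = exp (- (y\<^sup>2 * (sinh (t / y / 2))\<^sup>2 / 2))"
      by (simp add: cosh_square_eq power_mult_distrib field_simps flip: exp_add)
    have D: "damped_D \<alpha> (y * ?c) = of_real (exp (- (y * ?c)\<^sup>2 / 2)) * (of_real y powr (2 * \<alpha>) * of_real ?c powr (2 * \<alpha>)) * R (y * ?c)"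
      using y c by (subst damped_D_eq) (simp_all only: R_def eq1 mult_pos_pos)
    have "h y t = (of_real y powr (1 - 2 * \<alpha>) * of_real y powr (2 * \<alpha>)) * of_real (exp (y\<^sup>2 / 2) * exp (- (y * ?c)\<^sup>2 / 2))
        * of_real (1 / y) * (exp (\<nu> * of_real (t / y)) * R (y * ?c) * of_real ?c powr (2 * \<alpha>))"
      unfolding h_def cosh_integrand_def D scaleR_conv_of_real of_real_mult power_0 of_real_1
      by (simp only: mult_ac mult_1_right mult_1)
    also have "\<dots> = of_real y * of_real (exp (- (y\<^sup>2 * (sinh (t / y / 2))\<^sup>2 / 2)))
        * of_real (1 / y) * (exp (\<nu> * of_real (t / y)) * R (y * ?c) * of_real ?c powr (2 * \<alpha>))"
      by (simp only: eq2 eq3)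
    finally show ?thesis using y by simp
  qed
  \<comment> \<open>For y \<ge> N also y cosh (t / y / 2) \<ge> N, so the ratio is bounded by 2; N
    \<ge> 1 gives |t / y| \<le> |t|, which frees the other bounds from y.\<close>
  obtain N where N: "\<And>u. u \<ge> N \<Longrightarrow> norm (R u) \<le> 2" "N \<ge> 1"
  proof -
    have "eventually (\<lambda>u. dist (R u) 1 < 1) at_top" using R by (rule tendstoD) simp
    then obtain N where "\<And>u. u \<ge> N \<Longrightarrow> dist (R u) 1 < 1" by (auto simp: eventually_at_top_linorder)
    moreover have "norm (R u) \<le> 2" if "dist (R u) 1 < 1" for u
      using that norm_triangle_ineq2[of "R u" 1] by (simp add: dist_norm)
    ultimately show ?thesis by (intro that[of "max N 1"]) auto
  qed
  have "((\<lambda>y. \<integral>t. h y t \<partial>lborel) \<longlongrightarrow> (\<integral>t. complex_of_real (exp (- t\<^sup>2 / 8)) \<partial>lborel)) at_top"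
  proof (rule integral_dominated_convergence_at_top[where w = "\<lambda>t. 2 * exp (L * \<bar>t\<bar> - 1 / 16 * t\<^sup>2)"])
    show "(\<lambda>t. complex_of_real (exp (- t\<^sup>2 / 8))) \<in> borel_measurable lborel" by measurable
    show "h y \<in> borel_measurable lborel" for y
      unfolding h_def using borel_measurable_continuous_onI[OF continuous_on_cosh_integrand[OF cont, of \<nu> 0 y]]
      by measurable
    show "integrable lborel (\<lambda>t. 2 * exp (L * \<bar>t\<bar> - 1 / 16 * t\<^sup>2))"
      by (intro integrable_mult_right integrable_exp_abs_minus_square) simp
    show "eventually (\<lambda>y. AE t in lborel. norm (h y t) \<le> 2 * exp (L * \<bar>t\<bar> - 1 / 16 * t\<^sup>2)) at_top"
      using eventually_ge_at_top[of N]
    proof (eventually_elim, intro AE_I2)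
      fix y t :: real assume y: "N \<le> y"
      let ?c = "cosh (t / y / 2)"
      have y0: "y > 0" "y \<ge> 1" using y N by auto
      have ty: "\<bar>t / y\<bar> \<le> \<bar>t\<bar>" using y0 mult_left_mono[of 1 y "\<bar>t\<bar>"] by (simp add: field_simps)
      have "y * 1 \<le> y * ?c" using y0 by (intro mult_left_mono) (auto simp: cosh_real_ge_1)
      then have 1: "norm (R (y * ?c)) \<le> 2" using y by (intro N) simp
      have "norm \<nu> * \<bar>t / y\<bar> \<le> norm \<nu> * \<bar>t\<bar>" using ty by (intro mult_left_mono) auto
      then have 2: "norm (exp (\<nu> * of_real (t / y))) \<le> exp (norm \<nu> * \<bar>t\<bar>)"
        using norm_exp_mult_of_real_le[of \<nu> "t / y"] by (meson exp_le_cancel_iff order_trans)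
      have "\<bar>2 * Re \<alpha>\<bar> * \<bar>t / y / 2\<bar> \<le> \<bar>Re \<alpha>\<bar> * \<bar>t\<bar>"
        using mult_left_mono[OF ty abs_ge_zero[of "Re \<alpha>"]] by (simp add: abs_mult)
      then have 3: "norm (complex_of_real ?c powr (2 * \<alpha>)) \<le> exp (\<bar>Re \<alpha>\<bar> * \<bar>t\<bar>)"
        using cosh_powr_le[of "t / y / 2" "2 * Re \<alpha>"]
        by (subst norm_of_real_powr) (auto intro: order_trans)
      \<comment> \<open>The crude bound sinh^2 x \<ge> x^2 / 2 gives rate 1/16, half the rate of the
        limit, which suffices for a majorant.\<close>
      have "t\<^sup>2 / 16 = y\<^sup>2 * ((t / y / 2)\<^sup>2 / 2) / 2" using y0 by (simp add: field_simps)
      also have "\<dots> \<le> y\<^sup>2 * (sinh (t / y / 2))\<^sup>2 / 2"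
        by (intro divide_right_mono mult_left_mono sinh_square_ge) auto
      finally have 4: "norm (complex_of_real (exp (- (y\<^sup>2 * (sinh (t / y / 2))\<^sup>2 / 2)))) \<le> exp (- (t\<^sup>2 / 16))"
        by (simp del: of_real_exp)
      have "norm (h y t) \<le> exp (norm \<nu> * \<bar>t\<bar>) * 2 * exp (\<bar>Re \<alpha>\<bar> * \<bar>t\<bar>) * exp (- (t\<^sup>2 / 16))"
        unfolding h_eq[OF y0(1)] norm_mult by (intro mult_mono 1 2 3 4) auto
      also have "\<dots> = 2 * exp (norm \<nu> * \<bar>t\<bar> + \<bar>Re \<alpha>\<bar> * \<bar>t\<bar> + - (t\<^sup>2 / 16))"
        by (simp only: exp_add mult_ac)
      finally show "norm (h y t) \<le> 2 * exp (L * \<bar>t\<bar> - 1 / 16 * t\<^sup>2)"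
        by (simp add: L_def distrib_right)
    qed
    show "AE t in lborel. ((\<lambda>y. h y t) \<longlongrightarrow> of_real (exp (- t\<^sup>2 / 8))) at_top"
    proof (intro AE_I2)
      fix t :: real
      have ty: "((\<lambda>y. t / y) \<longlongrightarrow> 0) at_top"
        by (rule real_tendsto_divide_at_top[OF tendsto_const filterlim_ident])
      have c: "((\<lambda>y. cosh (t / y / 2)) \<longlongrightarrow> cosh (0 / 2)) at_top"
        by (intro tendsto_cosh tendsto_divide ty tendsto_const) auto
      have "filterlim (\<lambda>y::real. y * cosh (t / y / 2)) at_top at_top"
      proof (rule filterlim_at_top_mono[OF filterlim_ident])
        show "eventually (\<lambda>y. y \<le> y * cosh (t / y / 2)) at_top"
          using eventually_gt_at_top[of 0]
        proof eventually_elim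
          case (elim y)
          then show ?case using mult_left_mono[OF cosh_real_ge_1[of "t / y / 2"], of y] by simp
        qed
      qed
      from filterlim_compose[OF R this] have R': "((\<lambda>y. R (y * cosh (t / y / 2))) \<longlongrightarrow> 1) at_top" .
      have e: "((\<lambda>y. exp (\<nu> * complex_of_real (t / y))) \<longlongrightarrow> exp (\<nu> * of_real 0)) at_top"
        by (intro tendsto_exp tendsto_mult tendsto_of_real ty tendsto_const)
      have p: "((\<lambda>y. complex_of_real (cosh (t / y / 2)) powr (2 * \<alpha>)) \<longlongrightarrow> of_real (cosh (0 / 2)) powr (2 * \<alpha>)) at_top"
        by (intro tendsto_powr_complex tendsto_of_real c tendsto_const) auto
      have s: "((\<lambda>y. complex_of_real (exp (- (y\<^sup>2 * (sinh (t / y / 2))\<^sup>2 / 2)))) \<longlongrightarrow> of_real (exp (- ((t / 2)\<^sup>2 / 2)))) at_top"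
        by (intro tendsto_of_real tendsto_exp tendsto_minus tendsto_divide tendsto_square_mult_sinh_square tendsto_const) auto
      have "((\<lambda>y. exp (\<nu> * of_real (t / y)) * R (y * cosh (t / y / 2)) * of_real (cosh (t / y / 2)) powr (2 * \<alpha>)
          * of_real (exp (- (y\<^sup>2 * (sinh (t / y / 2))\<^sup>2 / 2)))) \<longlongrightarrow> of_real (exp (- t\<^sup>2 / 8))) at_top"
        using tendsto_mult[OF tendsto_mult[OF tendsto_mult[OF e R'] p] s] by (simp add: power_divide del: of_real_exp)
      then show "((\<lambda>y. h y t) \<longlongrightarrow> of_real (exp (- t\<^sup>2 / 8))) at_top"
      proof (rule Lim_transform_eventually)
        show "eventually (\<lambda>y. exp (\<nu> * of_real (t / y)) * R (y * cosh (t / y / 2)) * of_real (cosh (t / y / 2)) powr (2 * \<alpha>)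
          * of_real (exp (- (y\<^sup>2 * (sinh (t / y / 2))\<^sup>2 / 2))) = h y t) at_top"
          using eventually_gt_at_top[of 0] by eventually_elim (rule h_eq[symmetric])
      qed
    qed
  qed
  moreover have "eventually (\<lambda>y. (\<integral>t. h y t \<partial>lborel) =
      of_real y powr (1 - 2 * \<alpha>) * of_real (exp (y\<^sup>2 / 2)) * cosh_integral \<nu> 0 (damped_D \<alpha>) y) at_top"
    using eventually_gt_at_top[of 0]
  proof eventually_elim
    case (elim y)
    have "cosh_integral \<nu> 0 (damped_D \<alpha>) y = (1 / y) *\<^sub>R (\<integral>t. cosh_integrand \<nu> 0 (damped_D \<alpha>) y (t / y) \<partial>lborel)"
      unfolding cosh_integral_def
      using elim by (subst lborel_integral_real_affine[where c = "1 / y" and t = 0]) auto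
    then show ?case
      unfolding h_def by (simp only: integral_mult_right_zero Bochner_Integration.integral_scaleR_right)
  qed
  ultimately show ?thesis
    unfolding integral_exp_minus_square_8 by (rule Lim_transform_eventually)
qed

section \<open>Whittaker's function\<close>

text \<open>The coefficient tends to 1/4, so its product with the normalising function decays with
  that function. Values at z \<le> 0 must be matched too, because the description ranges over
  functions on the whole line.\<close>

lemma whittaker_W_eqI:
  assumes f0: "\<And>z. z \<le> 0 \<Longrightarrow> f z = 0"
    and f: "\<And>z. z > 0 \<Longrightarrow> (f has_vector_derivative g z) (at z)"
    and g: "\<And>z. z > 0 \<Longrightarrow> (g has_vector_derivative
              ((1/4 - \<kappa> / of_real z + (\<mu>\<^sup>2 - 1/4) / (of_real z)\<^sup>2) * f z)) (at z)"
    and fl: "((\<lambda>z. f z / (exp (- of_real z / 2) * of_real z powr \<kappa>)) \<longlongrightarrow> 1) at_top"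
  shows "whittaker_W \<kappa> \<mu> = f"
  unfolding whittaker_W_def
proof (rule the_equality)
  let ?q = "\<lambda>z::real. 1/4 - \<kappa> / of_real z + (\<mu>\<^sup>2 - 1/4) / (of_real z)\<^sup>2"
  let ?\<phi> = "\<lambda>z::real. exp (- of_real z / 2) * of_real z powr \<kappa>"
  show "(\<forall>z. z \<le> 0 \<longrightarrow> f z = 0) \<and>
     (\<exists>g. (\<forall>z>0. (f has_vector_derivative g z) (at z)) \<and>
          (\<forall>z>0. (g has_vector_derivative (?q z * f z)) (at z))) \<and>
     ((\<lambda>z. f z / ?\<phi> z) \<longlongrightarrow> 1) at_top"
    using f0 f g fl by blast
  fix h assume "(\<forall>z. z \<le> 0 \<longrightarrow> h z = 0) \<and>
     (\<exists>g. (\<forall>z>0. (h has_vector_derivative g z) (at z)) \<and>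
          (\<forall>z>0. (g has_vector_derivative (?q z * h z)) (at z))) \<and>
     ((\<lambda>z. h z / ?\<phi> z) \<longlongrightarrow> 1) at_top"
  then obtain k where h0: "\<And>z. z \<le> 0 \<Longrightarrow> h z = 0"
    and h: "\<And>z. z > 0 \<Longrightarrow> (h has_vector_derivative k z) (at z)"
    and k: "\<And>z. z > 0 \<Longrightarrow> (k has_vector_derivative ?q z * h z) (at z)"
    and hl: "((\<lambda>z. h z / ?\<phi> z) \<longlongrightarrow> 1) at_top"
    by blast
  have \<phi>: "(?\<phi> \<longlongrightarrow> 0) at_top"
  proof (rule tendsto_norm_zero_cancel, rule Lim_transform_eventually)
    show "((\<lambda>z. exp (- z / 2) * z powr Re \<kappa>) \<longlongrightarrow> 0) at_top" by real_asymp
    show "eventually (\<lambda>z. exp (- z / 2) * z powr Re \<kappa> = norm (?\<phi> z)) at_top"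
      using eventually_gt_at_top[of 0] by eventually_elim (simp add: norm_mult norm_of_real_powr)
  qed
  have inv: "((\<lambda>z::real. complex_of_real (1 / z)) \<longlongrightarrow> of_real 0) at_top"
    by (intro tendsto_of_real) real_asymp
  have "((\<lambda>z::real. 1/4 - \<kappa> * of_real (1 / z) + (\<mu>\<^sup>2 - 1/4) * (of_real (1 / z))\<^sup>2) \<longlongrightarrow>
      1/4 - \<kappa> * of_real 0 + (\<mu>\<^sup>2 - 1/4) * (of_real 0)\<^sup>2) at_top"
    by (intro tendsto_add tendsto_diff tendsto_mult tendsto_power tendsto_const inv)
  then have "(?q \<longlongrightarrow> 1/4) at_top" by (simp add: power_divide)
  from tendsto_mult[OF this \<phi>] have q: "((\<lambda>z. ?q z * ?\<phi> z) \<longlongrightarrow> 0) at_top" by simp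
  have "h z = f z" if "z > 0" for z
  proof (rule recessive_solution_unique[OF h k f g hl fl \<phi> q _ that])
    show "continuous_on {0<..} ?q" by (intro continuous_intros) auto
  qed
  then show "h = f" using f0 h0 by (metis ext not_less)
qed

text \<open>In the by-parts identity only \<open>cosh_integral \<nu> 0 F2\<close> is neither J nor a
  derivative of J in y. The equation for F at u = y cosh (s / 2) rewrites it through J and J', and
  the system closes.\<close>

lemma damped_D_cosh_integral_ode:
  obtains J1 J2 where
    "\<And>y. y > 0 \<Longrightarrow> (cosh_integral \<nu> 0 (damped_D \<alpha>) has_vector_derivative J1 y) (at y)"
    "\<And>y. y > 0 \<Longrightarrow> (J1 has_vector_derivative J2 y) (at y)"
    "\<And>y. y > 0 \<Longrightarrow> of_real (y\<^sup>2) * J2 y = (4 * \<nu>\<^sup>2 - of_real (y\<^sup>2) * (2 * \<alpha> + 1)) * cosh_integral \<nu> 0 (damped_D \<alpha>) y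
        - of_real (y + y ^ 3) * J1 y"
proof -
  let ?F = "damped_D \<alpha>"
  obtain F1 C where F1: "\<And>u. (?F has_vector_derivative F1 u) (at u)"
    and F2: "\<And>u. (F1 has_vector_derivative - of_real u * F1 u - (2 * \<alpha> + 1) * ?F u) (at u)"
    and b0: "\<And>u. u \<ge> 0 \<Longrightarrow> norm (?F u) \<le> C * exp (- u\<^sup>2 / 8)"
    and b1: "\<And>u. u \<ge> 0 \<Longrightarrow> norm (F1 u) \<le> C * exp (- u\<^sup>2 / 8)"
    and b2: "\<And>u. u \<ge> 0 \<Longrightarrow> norm (- of_real u * F1 u - (2 * \<alpha> + 1) * ?F u) \<le> C * exp (- u\<^sup>2 / 8)"
    by (rule damped_D_obtain[of \<alpha>]) blast
  define F2 where "F2 = (\<lambda>u. - of_real u * F1 u - (2 * \<alpha> + 1) * ?F u)"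
  note F2' = F2[folded F2_def[THEN fun_cong]] and b2' = b2[folded F2_def[THEN fun_cong]]
  have cont: "continuous_on UNIV ?F" "continuous_on UNIV F1"
    using F1 F2' by (auto intro!: continuous_at_imp_continuous_on has_vector_derivative_continuous)
  have cont2: "continuous_on UNIV F2"
    unfolding F2_def using cont by (intro continuous_intros)
  show thesis
  proof (rule that[of "cosh_integral \<nu> 1 F1" "cosh_integral \<nu> 2 F2"])
    fix y :: real assume y: "y > 0"
    show "(cosh_integral \<nu> 0 ?F has_vector_derivative cosh_integral \<nu> 1 F1 y) (at y)"
      using cosh_integral_deriv[OF F1 cont(2) b0 b1 y, of \<nu> 0] by simp
    show "(cosh_integral \<nu> 1 F1 has_vector_derivative cosh_integral \<nu> 2 F2 y) (at y)"
      using cosh_integral_deriv[OF F2' cont2 b1 b2' y, of \<nu> 1] by (simp add: numeral_2_eq_2)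
    have "cosh_integrand \<nu> 0 F2 y = (\<lambda>s. - of_real y * cosh_integrand \<nu> 1 F1 y s - (2 * \<alpha> + 1) * cosh_integrand \<nu> 0 ?F y s)"
      by (simp add: fun_eq_iff cosh_integrand_def F2_def algebra_simps)
    then have "cosh_integral \<nu> 0 F2 y = - of_real y * cosh_integral \<nu> 1 F1 y - (2 * \<alpha> + 1) * cosh_integral \<nu> 0 ?F y"
      using integrable_cosh_integrand[OF cont(2) b1 y, of \<nu> 1] integrable_cosh_integrand[OF cont(1) b0 y, of \<nu> 0]
      by (simp add: cosh_integral_def)
    with cosh_integral_by_parts[OF F1 F2' cont2 b0 b1 b2' y, of \<nu>]
    have "4 * (of_real (y\<^sup>2 / 4) * (cosh_integral \<nu> 2 F2 y - (- of_real y * cosh_integral \<nu> 1 F1 y - (2 * \<alpha> + 1) * cosh_integral \<nu> 0 ?F y))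
       + of_real (y / 4) * cosh_integral \<nu> 1 F1 y) = 4 * (\<nu>\<^sup>2 * cosh_integral \<nu> 0 ?F y)" by simp
    then show "of_real (y\<^sup>2) * cosh_integral \<nu> 2 F2 y = (4 * \<nu>\<^sup>2 - of_real (y\<^sup>2) * (2 * \<alpha> + 1)) * cosh_integral \<nu> 0 ?F y
        - of_real (y + y ^ 3) * cosh_integral \<nu> 1 F1 y"
      by (simp add: algebra_simps power2_eq_square power3_eq_cube)
  qed
qed

text \<open>In the variable z = y^2 / 2 the equation for J has first-order term (1 / z + 1) J_z;
  sqrt z exp (z / 2) is the Liouville factor that removes it. The constant is the reciprocal of sqrt
  (8 pi) 2^(\<alpha> - 1/2), which Laplace's method yields at y = sqrt (2 z).\<close>

definition whittaker_candidate :: "complex \<Rightarrow> complex \<Rightarrow> real \<Rightarrow> complex" where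
  "whittaker_candidate \<alpha> \<nu> z = (if z \<le> 0 then 0 else
     2 powr (- 1 - \<alpha>) * of_real (1 / sqrt pi) * of_real (sqrt z * exp (z / 2)) * cosh_integral \<nu> 0 (damped_D \<alpha>) (sqrt (2 * z)))"

lemma whittaker_candidate_asymp:
  "((\<lambda>z. whittaker_candidate \<alpha> \<nu> z / (exp (- of_real z / 2) * of_real z powr \<alpha>)) \<longlongrightarrow> 1) at_top"
proof (rule Lim_transform_eventually)
  let ?J = "cosh_integral \<nu> 0 (damped_D \<alpha>)"
  have "filterlim (\<lambda>z::real. sqrt (2 * z)) at_top at_top" by real_asymp
  from tendsto_mult[OF tendsto_const[of "complex_of_real (1 / sqrt (8 * pi))"]
      filterlim_compose[OF cosh_integral_damped_D_asymp[of \<alpha> \<nu>] this]]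
  have "((\<lambda>z. of_real (1 / sqrt (8 * pi)) * (of_real (sqrt (2 * z)) powr (1 - 2 * \<alpha>) * of_real (exp ((sqrt (2 * z))\<^sup>2 / 2)) * ?J (sqrt (2 * z))))
      \<longlongrightarrow> of_real (1 / sqrt (8 * pi)) * of_real (sqrt (8 * pi))) at_top" .
  also have "complex_of_real (1 / sqrt (8 * pi)) * of_real (sqrt (8 * pi)) = 1"
    unfolding of_real_mult[symmetric] by (simp del: of_real_mult)
  finally show "((\<lambda>z. of_real (1 / sqrt (8 * pi)) * (of_real (sqrt (2 * z)) powr (1 - 2 * \<alpha>) * of_real (exp ((sqrt (2 * z))\<^sup>2 / 2)) * ?J (sqrt (2 * z))))
      \<longlongrightarrow> 1) at_top" .
  show "eventually (\<lambda>z. of_real (1 / sqrt (8 * pi)) * (of_real (sqrt (2 * z)) powr (1 - 2 * \<alpha>) * of_real (exp ((sqrt (2 * z))\<^sup>2 / 2)) * ?J (sqrt (2 * z)))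
     = whittaker_candidate \<alpha> \<nu> z / (exp (- of_real z / 2) * of_real z powr \<alpha>)) at_top"
    using eventually_gt_at_top[of 0]
  proof eventually_elim
    case (elim z)
    have p: "complex_of_real (sqrt (2 * z)) powr (1 - 2 * \<alpha>) = of_real (sqrt 2) * of_real (sqrt z) * 2 powr (- \<alpha>) / of_real z powr \<alpha>"
    proof -
      have "complex_of_real (sqrt (2 * z)) powr (1 - 2 * \<alpha>) = of_real (sqrt (2 * z)) / of_real (sqrt (2 * z)) powr (2 * \<alpha>)"
        using elim by (simp add: powr_diff)
      also have "complex_of_real (sqrt (2 * z)) powr (2 * \<alpha>) = of_real 2 powr \<alpha> * of_real z powr \<alpha>"
        using elim
        by (simp add: of_real_powr_eq_exp_ln ln_sqrt ln_mult ring_distribs flip: exp_add del: of_real_numeral)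
          (simp add: add_divide_distrib)
      finally show ?thesis by (simp add: real_sqrt_mult powr_minus field_simps)
    qed
    have s8: "sqrt (8 * pi) = 2 * sqrt 2 * sqrt pi"
    proof -
      have "sqrt (8 * pi) = sqrt (2\<^sup>2 * 2 * pi)" by simp
      then show ?thesis by (simp only: real_sqrt_mult real_sqrt_abs abs_numeral)
    qed
    have two: "(2::complex) powr (- 1 - \<alpha>) = 2 powr (- \<alpha>) / 2"
    proof -
      have "(2::complex) powr (- 1 - \<alpha>) = 2 powr (- \<alpha> - 1)" by (rule arg_cong) simp
      also have "\<dots> = 2 powr (- \<alpha>) / 2 powr 1" by (rule powr_diff)
      finally show ?thesis by simp
    qed
    have e: "complex_of_real (exp (z / 2)) / exp (- of_real z / 2) = of_real (exp z)"
      by (simp flip: exp_diff exp_of_real)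
    have "whittaker_candidate \<alpha> \<nu> z / (exp (- of_real z / 2) * of_real z powr \<alpha>) =
        2 powr (- \<alpha>) / 2 * of_real (1 / sqrt pi) * of_real (sqrt z) * (of_real (exp (z / 2)) / exp (- of_real z / 2)) * ?J (sqrt (2 * z)) / of_real z powr \<alpha>"
      using elim by (simp add: whittaker_candidate_def two mult.assoc del: of_real_exp exp_of_real)
    also have "\<dots> = of_real (1 / sqrt (8 * pi)) * (of_real (sqrt (2 * z)) powr (1 - 2 * \<alpha>) * of_real (exp ((sqrt (2 * z))\<^sup>2 / 2)) * ?J (sqrt (2 * z)))"
      unfolding p s8 e using elim by (simp del: of_real_exp exp_of_real)
    finally show ?case by simp
  qed
qed

lemma whittaker_W_eq_candidate: "whittaker_W \<alpha> \<nu> = whittaker_candidate \<alpha> \<nu>"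
proof -
  let ?J = "cosh_integral \<nu> 0 (damped_D \<alpha>)"
  obtain J1 J2 where J1: "\<And>y. y > 0 \<Longrightarrow> (?J has_vector_derivative J1 y) (at y)"
    and J2: "\<And>y. y > 0 \<Longrightarrow> (J1 has_vector_derivative J2 y) (at y)"
    and ode: "\<And>y. y > 0 \<Longrightarrow> of_real (y\<^sup>2) * J2 y = (4 * \<nu>\<^sup>2 - of_real (y\<^sup>2) * (2 * \<alpha> + 1)) * ?J y - of_real (y + y ^ 3) * J1 y"
    using damped_D_cosh_integral_ode[of \<nu> \<alpha>] by metis
  define c where "c = 2 powr (- 1 - \<alpha>) * complex_of_real (1 / sqrt pi)"
  define y where "y = (\<lambda>z::real. sqrt (2 * z))"
  define a where "a = (\<lambda>z::real. sqrt z * exp (z / 2))"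
  \<comment> \<open>The logarithmic derivative of \<open>a\<close>.\<close>
  define b where "b = (\<lambda>z::real. 1 / (2 * z) + 1 / 2)"
  define f where "f = (\<lambda>z. c * of_real (a z) * ?J (y z))"
  define g where "g = (\<lambda>z. c * of_real (a z) * (of_real (b z) * ?J (y z) + of_real (1 / y z) * J1 (y z)))"
  have y': "(y has_real_derivative 1 / y z) (at z)" if "z > 0" for z
    unfolding y_def using that by (auto intro!: derivative_eq_intros simp: field_simps real_sqrt_mult)
  have a': "((\<lambda>z. complex_of_real (a z)) has_vector_derivative of_real (a z * b z)) (at z)" if "z > 0" for z
  proof (rule has_vector_derivative_of_real)
    have "sqrt z * sqrt z = z" using that by simp
    then show "(a has_real_derivative a z * b z) (at z)"
      unfolding a_def b_def using that by (auto intro!: derivative_eq_intros simp: field_simps)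
  qed
  have b': "((\<lambda>z. complex_of_real (b z)) has_vector_derivative of_real (- 1 / (2 * z\<^sup>2))) (at z)" if "z > 0" for z
    by (rule has_vector_derivative_of_real)
       (use that in \<open>auto intro!: derivative_eq_intros simp: b_def[abs_def] field_simps power2_eq_square\<close>)
  have iy': "((\<lambda>z. complex_of_real (1 / y z)) has_vector_derivative of_real (- 1 / y z ^ 3)) (at z)" if "z > 0" for z
    by (rule has_vector_derivative_of_real)
       (use that y'[OF that] in \<open>auto intro!: derivative_eq_intros simp: y_def field_simps power3_eq_cube\<close>)
  have f': "(f has_vector_derivative g z) (at z)" if z: "z > 0" for z
  proof -
    have yz: "y z > 0" using z by (simp add: y_def)
    show ?thesis
      unfolding f_def mult.assoc
      by (rule has_vector_derivative_eq_rhs,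
          (rule has_vector_derivative_mult_right has_vector_derivative_mult a'[OF z]
            has_vector_derivative_chain_real[OF y'[OF z] J1[OF yz]])+)
         (simp add: g_def algebra_simps)
  qed
  have g': "(g has_vector_derivative (1/4 - \<alpha> / of_real z + (\<nu>\<^sup>2 - 1/4) / (of_real z)\<^sup>2) * f z) (at z)" if z: "z > 0" for z
  proof -
    have yz: "y z > 0" using z by (simp add: y_def)
    let ?z = "complex_of_real z" and ?Y = "complex_of_real (y z)"
    have YY: "?Y * ?Y = 2 * ?z" using z unfolding of_real_mult[symmetric] by (simp add: y_def)
    have nz: "?z \<noteq> 0" "?Y \<noteq> 0" using z yz by auto
    have ode': "?Y * ?Y * J2 (y z) = (4 * \<nu>\<^sup>2 - ?Y * ?Y * (2 * \<alpha> + 1)) * ?J (y z) - (?Y + ?Y * (?Y * ?Y)) * J1 (y z)"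
      using ode[OF yz] by (simp add: power2_eq_square power3_eq_cube mult.assoc)
    have J2eq: "J2 (y z) = ((4 * \<nu>\<^sup>2 - 2 * ?z * (2 * \<alpha> + 1)) * ?J (y z) - (?Y + ?Y * (2 * ?z)) * J1 (y z)) / (2 * ?z)"
      using ode' nz unfolding YY by (simp add: field_simps)
    have iY: "of_real (1 / y z) = ?Y / (2 * ?z)" "of_real (1 / y z ^ 3) = ?Y / (4 * ?z * ?z)"
    proof -
      show 1: "of_real (1 / y z) = ?Y / (2 * ?z)" using nz YY by (simp add: divide_simps)
      have "complex_of_real (1 / y z ^ 3) = of_real (1 / y z) * (1 / (?Y * ?Y))"
        by (simp add: power3_eq_cube)
      then show "of_real (1 / y z ^ 3) = ?Y / (4 * ?z * ?z)" unfolding 1 YY by simp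
    qed
    have "(g has_vector_derivative c * (of_real (a z) *
          ((of_real (b z) * (of_real (1 / y z) * J1 (y z)) + of_real (- 1 / (2 * z\<^sup>2)) * ?J (y z)) +
           (of_real (1 / y z) * (of_real (1 / y z) * J2 (y z)) + of_real (- 1 / y z ^ 3) * J1 (y z))) +
          of_real (a z * b z) * (of_real (b z) * ?J (y z) + of_real (1 / y z) * J1 (y z)))) (at z)"
      unfolding g_def mult.assoc
      by (rule has_vector_derivative_mult_right has_vector_derivative_add has_vector_derivative_mult a'[OF z] b'[OF z] iy'[OF z]
            has_vector_derivative_chain_real[OF y'[OF z] J1[OF yz]] has_vector_derivative_chain_real[OF y'[OF z] J2[OF yz]])+
    also have "of_real (- 1 / y z ^ 3) = - (?Y / (4 * ?z * ?z))" using iY(2) by simp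
    also have "c * (of_real (a z) *
          ((of_real (b z) * (of_real (1 / y z) * J1 (y z)) + of_real (- 1 / (2 * z\<^sup>2)) * ?J (y z)) +
           (of_real (1 / y z) * (of_real (1 / y z) * J2 (y z)) + - (?Y / (4 * ?z * ?z)) * J1 (y z))) +
          of_real (a z * b z) * (of_real (b z) * ?J (y z) + of_real (1 / y z) * J1 (y z))) =
       c * of_real (a z) * ((of_real (b z) * of_real (b z) - 1 / (2 * ?z * ?z)) * ?J (y z)
         + (2 * of_real (b z) * (?Y / (2 * ?z)) - ?Y / (4 * ?z * ?z)) * J1 (y z) + (?Y * ?Y) / (4 * ?z * ?z) * J2 (y z))"
      unfolding iY by (simp add: power2_eq_square algebra_simps)
    \<comment> \<open>The coefficient of \<open>J1\<close> cancels identically, as the choice of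
      \<open>a\<close> intends. That of J is b^2 - 1 / (2 z^2) + \<nu>^2 / z^2 - (2 \<alpha> + 1) /
      (2 z), which is Whittaker's.\<close>
    also have "\<dots> = (1/4 - \<alpha> / ?z + (\<nu>\<^sup>2 - 1/4) / ?z\<^sup>2) * f z"
      unfolding YY J2eq f_def b_def using nz by (simp add: field_simps power2_eq_square)
    finally show ?thesis .
  qed
  show ?thesis
  proof (rule whittaker_W_eqI[OF _ _ _ whittaker_candidate_asymp])
    fix z :: real assume z: "z > 0"
    show "(whittaker_candidate \<alpha> \<nu> has_vector_derivative g z) (at z)"
      using f'[OF z] has_vector_derivative_transform_within_open[of f "g z" z "{0<..}" "whittaker_candidate \<alpha> \<nu>"] z
      by (auto simp: f_def whittaker_candidate_def c_def a_def y_def)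
    have "f z = whittaker_candidate \<alpha> \<nu> z"
      using z by (simp add: f_def whittaker_candidate_def c_def a_def y_def)
    then show "(g has_vector_derivative (1/4 - \<alpha> / of_real z + (\<nu>\<^sup>2 - 1/4) / (of_real z)\<^sup>2) * whittaker_candidate \<alpha> \<nu> z) (at z)"
      using g'[OF z] by simp
  qed (simp add: whittaker_candidate_def)
qed

section \<open>The integral representation and its even form\<close>

text \<open>The cosh^2 term in the exponent of \<open>eta\<close> is the Gaussian factor of
  \<open>damped_D\<close> at u = cosh (s / 2) / x, so y is 1 / x.\<close>

lemma exp_mult_eta:
  assumes "x > 0"
  shows "exp (\<nu> * of_real s) * eta \<alpha> x s =
    of_real (2 powr (- 3 / 2) * pi powr (- 1 / 2)) * of_real x powr (- 1 + 2 * \<alpha>) * of_real (exp (1 / (2 * x\<^sup>2)))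
    * cosh_integrand \<nu> 0 (damped_D \<alpha>) (1 / x) s"
proof -
  have "exp (1 / (2 * x\<^sup>2) - (cosh (s / 2))\<^sup>2 / (4 * x\<^sup>2)) = exp (1 / (2 * x\<^sup>2)) * exp (- (1 / x * cosh (s / 2))\<^sup>2 / 4)"
    by (simp add: power_divide flip: exp_add)
  then show ?thesis
    unfolding eta_def cosh_integrand_def damped_D_def by (simp add: mult_ac del: of_real_exp exp_of_real)
qed

text \<open>At z = 1 / (2 x^2) one has sqrt (2 z) = 1 / x. The factor exp (1 / (4 x^2)) of
  \<open>boldW\<close> meets an equal one, exp (z / 2), and 2^(-3/2) arises as 2^\<alpha>
  2^(-1-\<alpha>) / sqrt 2, the last factor coming from sqrt z.\<close>

lemma boldW_eq_cosh_integral: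
  assumes "x > 0"
  shows "boldW \<alpha> \<nu> x =
    of_real (2 powr (- 3 / 2) * pi powr (- 1 / 2)) * of_real x powr (- 1 + 2 * \<alpha>) * of_real (exp (1 / (2 * x\<^sup>2)))
    * cosh_integral \<nu> 0 (damped_D \<alpha>) (1 / x)"
proof -
  have s: "sqrt (2 * (1 / (2 * x\<^sup>2))) = 1 / x" "sqrt (1 / (2 * x\<^sup>2)) = 1 / (sqrt 2 * x)"
    using assms by (simp_all add: real_sqrt_divide real_sqrt_mult)
  have two: "(2::complex) powr \<alpha> * 2 powr (- 1 - \<alpha>) = 1 / 2"
    by (simp flip: powr_add add: powr_minus_divide)
  have half: "2 powr (- 3 / 2) = 1 / (2 * sqrt 2)" "pi powr (- 1 / 2) = 1 / sqrt pi"
  proof -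
    have "(2::real) powr (- 3 / 2) = 2 powr (- 1) * 2 powr (- (1 / 2))"
      by (subst powr_add[symmetric]) simp
    also have "\<dots> = 1 / (2 * sqrt 2)" by (simp add: powr_minus powr_half_sqrt field_simps)
    finally show "2 powr (- 3 / 2) = 1 / (2 * sqrt 2)" .
    have "pi powr (- 1 / 2) = pi powr (- (1 / 2))" by simp
    also have "\<dots> = 1 / sqrt pi" by (simp only: powr_minus) (simp add: powr_half_sqrt field_simps)
    finally show "pi powr (- 1 / 2) = 1 / sqrt pi" .
  qed
  have x: "complex_of_real x powr (- 1 + 2 * \<alpha>) = of_real x powr (2 * \<alpha>) / of_real x"
    using assms powr_diff[of "complex_of_real x" "2 * \<alpha>" 1] by simp
  have e: "exp (1 / (4 * x\<^sup>2)) * exp (1 / (2 * x\<^sup>2) / 2) = exp (1 / (2 * x\<^sup>2))"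
    by (simp flip: exp_add)
  have "boldW \<alpha> \<nu> x = (2 powr \<alpha> * 2 powr (- 1 - \<alpha>)) * of_real x powr (2 * \<alpha>) * of_real (1 / sqrt pi) * of_real (1 / (sqrt 2 * x))
      * of_real (exp (1 / (4 * x\<^sup>2)) * exp (1 / (2 * x\<^sup>2) / 2)) * cosh_integral \<nu> 0 (damped_D \<alpha>) (1 / x)"
    using assms unfolding boldW_def whittaker_W_eq_candidate whittaker_candidate_def s
    by (simp add: mult_ac del: of_real_exp exp_of_real)
  then show ?thesis
    unfolding two half x e by (simp add: mult_ac del: of_real_exp exp_of_real)
qed

lemma eta_minus: "eta \<alpha> x (- s) = eta \<alpha> x s"
  by (simp add: eta_def)

lemma integral_even_eq_twice:
  fixes f :: "real \<Rightarrow> complex"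
  assumes f: "integrable lborel f" and even: "\<And>s. f (- s) = f s"
  shows "set_integrable lborel {0..} f" "integral\<^sup>L lborel f = 2 * (LINT s:{0..}|lborel. f s)"
proof -
  show pos: "set_integrable lborel {0..} f"
    using f by (simp add: set_integrable_def integrable_mult_indicator)
  have neg: "set_integrable lborel {..<0} f"
    using f by (simp add: set_integrable_def integrable_mult_indicator)
  have "integral\<^sup>L lborel f = (LINT s:{0..} \<union> {..<0}|lborel. f s)"
  proof -
    have "{0..} \<union> {..<0} = (UNIV :: real set)" by auto
    then show ?thesis by (simp add: set_lebesgue_integral_def)
  qed
  also have "\<dots> = (LINT s:{0..}|lborel. f s) + (LINT s:{..<0}|lborel. f s)"
    by (rule set_integral_Un[OF _ pos neg]) auto
  also have "(LINT s:{..<0}|lborel. f s) = (LINT s:{0..}|lborel. f s)"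
  proof -
    have "(LINT s:{..<0}|lborel. f s) = (\<integral>s. indicator {..<0} (- s) *\<^sub>R f s \<partial>lborel)"
      unfolding set_lebesgue_integral_def
      by (subst lborel_integral_real_affine[where c = "-1" and t = 0]) (simp_all add: even)
    also have "\<dots> = (LINT s:{0..}|lborel. f s)"
      unfolding set_lebesgue_integral_def
    proof (rule integral_cong_AE)
      \<comment> \<open>Reflection turns the open negative half-line into the open positive one; the
        missing point 0 is a null set.\<close>
      show "AE s in lborel. indicator {..<0} (- s) *\<^sub>R f s = indicator {0..} s *\<^sub>R f s"
        using AE_lborel_singleton[of 0] by eventually_elim (auto simp: indicator_def)
    qed (use f in auto)
    finally show ?thesis .
  qed
  finally show "integral\<^sup>L lborel f = 2 * (LINT s:{0..}|lborel. f s)" by simp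
qed

theorem mainTheorem2:
  fixes \<alpha> \<nu> :: complex and x :: real
  assumes "x > 0"
  shows "integrable lborel (\<lambda>s. exp (\<nu> * of_real s) * eta \<alpha> x s)
    \<and> set_integrable lborel {0..} (\<lambda>s. cosh (\<nu> * of_real s) * eta \<alpha> x s)
    \<and> boldW \<alpha> \<nu> x = (\<integral>s. exp (\<nu> * of_real s) * eta \<alpha> x s \<partial>lborel)
    \<and> boldW \<alpha> \<nu> x = 2 * (LINT s:{0..}|lborel. cosh (\<nu> * of_real s) * eta \<alpha> x s)"
proof -
  let ?f = "\<lambda>\<nu> s. exp (\<nu> * of_real s) * eta \<alpha> x s"
  obtain F' C where F': "\<And>u. (damped_D \<alpha> has_vector_derivative F' u) (at u)"
    and bound: "\<And>u. u \<ge> 0 \<Longrightarrow> norm (damped_D \<alpha> u) \<le> C * exp (- u\<^sup>2 / 8)"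
    by (rule damped_D_obtain[of \<alpha>]) blast
  have "continuous_on UNIV (damped_D \<alpha>)"
    using F' by (auto intro!: continuous_at_imp_continuous_on has_vector_derivative_continuous)
  \<comment> \<open>Needed at both \<nu> and -\<nu>, because cosh is the half-sum of the two
    exponentials.\<close>
  then have int: "integrable lborel (?f \<nu>)" for \<nu>
    unfolding exp_mult_eta[OF assms] using bound assms
    by (intro integrable_mult_right integrable_cosh_integrand) auto
  have W: "boldW \<alpha> \<nu> x = integral\<^sup>L lborel (?f \<nu>)"
    unfolding exp_mult_eta[OF assms] boldW_eq_cosh_integral[OF assms] cosh_integral_def by simp
  let ?g = "\<lambda>s. cosh (\<nu> * of_real s) * eta \<alpha> x s"
  have g: "?g = (\<lambda>s. (?f \<nu> s + ?f (- \<nu>) s) / 2)"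
    by (simp add: cosh_field_def fun_eq_iff field_simps)
  \<comment> \<open>Since \<open>eta\<close> is even in s, replacing s by -s exchanges \<nu> and
    -\<nu>; both halves of cosh therefore have the same integral.\<close>
  have reflect: "integral\<^sup>L lborel (?f \<nu>) = integral\<^sup>L lborel (?f (- \<nu>))"
    by (subst lborel_integral_real_affine[where c = "-1" and t = 0]) (simp_all add: eta_minus)
  have gint: "integrable lborel ?g"
    unfolding g using int[of \<nu>] int[of "- \<nu>"] by (intro integrable_divide Bochner_Integration.integrable_add) auto
  have even: "?g (- s) = ?g s" for s by (simp add: eta_minus)
  have "integral\<^sup>L lborel ?g = integral\<^sup>L lborel (?f \<nu>)"
    unfolding g using int[of \<nu>] int[of "- \<nu>"] reflect by simp
  then show ?thesis
    using integral_even_eq_twice[OF gint even] int[of \<nu>] W by simp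
qed

end
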